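(* Let $A_1,A_2,A_3$ be $2$-convex sets of real numbers, each with $N$ elements, and for $r\geq1$ let $X_r=\{x\in A_1+A_2+A_3:\ r\leq r_{A_1+A_2+A_3}(x)<2r\}$. Then \[ |X_r|\ll \frac{N^{14/3}}{r^{5/2}}. \] In particular $T(A_1,A_2,A_3)\ll N^{4+1/9}$.
   Context: A finite real sequence $(x_1,\dots,x_m)$ is $0$-convex if strictly monotone, and for $s\geq1$ it is $s$-convex if $(x_{i+1}-x_i)_{i=1}^{m-1}$ is $(s-1)$-convex; a finite set is $s$-convex if its increasing enumeration is an $s$-convex sequence. $r_{A_1+A_2+A_3}(x)$ is the number of $(a_1,a_2,a_3)\in A_1\times A_2\times A_3$ with $a_1+a_2+a_3=x$. $T(A_1,A_2,A_3)$ is the number of solutions of $a_1+a_2+a_3=a_1'+a_2'+a_3'$ with $a_i,a_i'\in A_i$. *)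

theory Defs
  imports Complex_Main
begin

definition diffs :: "real list \<Rightarrow> real list" where
  "diffs xs = map2 (\<lambda>a b. b - a) xs (tl xs)"

fun convex_seq :: "nat \<Rightarrow> real list \<Rightarrow> bool" where
  "convex_seq 0 xs = (sorted_wrt (<) xs \<or> sorted_wrt (>) xs)"
| "convex_seq (Suc s) xs = convex_seq s (diffs xs)"

definition convex_set :: "nat \<Rightarrow> real set \<Rightarrow> bool" where
  "convex_set s A = (finite A \<and> convex_seq s (sorted_list_of_set A))"

definition rep3 :: "real set \<Rightarrow> real set \<Rightarrow> real set \<Rightarrow> real \<Rightarrow> nat" where
  "rep3 A1 A2 A3 x = card {(a1, a2, a3). a1 \<in> A1 \<and> a2 \<in> A2 \<and> a3 \<in> A3 \<and> a1 + a2 + a3 = x}"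

definition sumset3 :: "real set \<Rightarrow> real set \<Rightarrow> real set \<Rightarrow> real set" where
  "sumset3 A1 A2 A3 = {a1 + a2 + a3 | a1 a2 a3. a1 \<in> A1 \<and> a2 \<in> A2 \<and> a3 \<in> A3}"

definition energy3 :: "real set \<Rightarrow> real set \<Rightarrow> real set \<Rightarrow> nat" where
  "energy3 A1 A2 A3 = card {((a1, a2, a3), (b1, b2, b3)).
     a1 \<in> A1 \<and> a2 \<in> A2 \<and> a3 \<in> A3 \<and> b1 \<in> A1 \<and> b2 \<in> A2 \<and> b3 \<in> A3 \<and>
     a1 + a2 + a3 = b1 + b2 + b3}"

end

theory Submission
  imports Defs
begin

text \<open>
  Enumerate \<open>A1, A2, A3\<close> increasingly as \<open>a, b, c\<close>. The index triples solving \<open>a i + b j + c k = x\<close> form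
  an antichain in the cube \<open>[N]^3\<close>, so boxes of side \<open>L ~ N / sqrt r\<close> force at least half of the \<open>r\<close>
  solutions to share a box with another one. If such a pair differs in all three coordinates, it is a zero
  sum of elements of \<open>a (i + d) - a i\<close>, \<open>b (j + e) - b j\<close>, \<open>c (k + f) - c k\<close> up to signs. For fixed
  \<open>d, e, f\<close> these sequences are convex by 2-convexity, so there are \<open>O(N^(5/3))\<close> zero sums, and
  \<open>|X| r = O(L^3 N^(5/3))\<close>, which is the claim. If instead the pairs share a coordinate, say \<open>i\<close>, then
  \<open>x - a i\<close> is one of the few sums \<open>b j + c k\<close> with two nearby representations, and the convex
  incidence bound, applied to \<open>a\<close> and to \<open>b\<close>, settles this case too. The incidence bound is an
  elementary pigeonhole argument in the spirit of Garaev. The energy bound sums the level set bound dyadically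
  above \<open>r = N^(10/9)\<close>.
\<close>

section \<open>Incidences of a convex sequence\<close>

text \<open>Distinct elements of \<open>S\<close> have distinct ranks, and a block consists of only
  \<open>K\<close> consecutive ranks.\<close>

lemma card_block_le:
  fixes S :: "real set" and K :: nat
  assumes "finite S" "K > 0"
  shows "card {s \<in> S. card {t \<in> S. t < s} div K = m} \<le> K"
proof -
  have "inj_on (\<lambda>s. card {t \<in> S. t < s}) {s \<in> S. card {t \<in> S. t < s} div K = m}"
  proof (rule linorder_inj_onI')
    fix x y assume "x \<in> {s \<in> S. card {t \<in> S. t < s} div K = m}" "x < y"
    then have "{t \<in> S. t < x} \<subset> {t \<in> S. t < y}" by auto
    then have "card {t \<in> S. t < x} < card {t \<in> S. t < y}"
      using assms by (intro psubset_card_mono) auto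
    then show "card {t \<in> S. t < x} \<noteq> card {t \<in> S. t < y}" by simp
  qed
  moreover have "(\<lambda>s. card {t \<in> S. t < s}) ` {s \<in> S. card {t \<in> S. t < s} div K = m} \<subseteq> {m*K..<m*K+K}"
    using dividend_less_times_div[OF assms(2)] by (auto simp: ac_simps)
  ultimately show ?thesis
    using card_inj_on_le[of _ _ "{m*K..<m*K+K}"] by fastforce
qed

text \<open>Along a fixed \<open>b\<close> both block indices increase with \<open>i\<close>, so their sum already determines
  the pair of blocks. Two points in the same pair of blocks are recovered from
  \<open>(f i + b, f j + b, j - i)\<close> because the differences of \<open>f\<close> are injective.\<close>

lemma card_incidences_le_blocks:
  fixes f :: "nat \<Rightarrow> real"
  assumes mono: "strict_mono_on {p..<q} f"
    and inj: "\<And>d. d > 0 \<Longrightarrow> inj_on (\<lambda>i. f (i + d) - f i) {i. p \<le> i \<and> i + d < q}"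
    and "q \<le> n" and fin: "finite B" "finite S" and pos: "D > 0" "K > 0"
  shows "card {(i, b). p \<le> i \<and> i < q \<and> b \<in> B \<and> f i + b \<in> S}
    \<le> card B * (n div D + card S div K + 1) + card S * (K * D)"
proof -
  define rk where "rk s = card {t \<in> S. t < s}" for s
  define E where "E = {(i, b). p \<le> i \<and> i < q \<and> b \<in> B \<and> f i + b \<in> S}"
  \<comment> \<open>For fixed \<open>b\<close> the sum of the two block indices takes at most
    \<open>n div D + card S div K + 1\<close> values, whereas the pair of indices could a priori
    take about the product of the two counts.\<close>
  define key where "key = (\<lambda>(i, b). (b, i div D + rk (f i + b) div K))"
  \<comment> \<open>\<open>P\<close> omits exactly the last incidence of each key class. The omitted
    ones are therefore at most as many as the keys, and every member of \<open>P\<close> has a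
    successor in its class.\<close>
  define P where "P = {(i, b) \<in> E. \<exists>j>i. (j, b) \<in> E \<and> key (j, b) = key (i, b)}"
  have rk_mono: "rk s \<le> rk t" if "s \<le> t" for s t
    unfolding rk_def using that fin by (intro card_mono) auto
  have rk_le: "rk s \<le> card S" for s
    unfolding rk_def using fin by (intro card_mono) auto
  have finE: "finite E"
    using fin by (intro finite_subset[of E "{p..<q} \<times> B"]) (auto simp: E_def)
  have keyB: "key ` E \<subseteq> B \<times> {..n div D + card S div K}"
  proof -
    have "i div D + rk s div K \<le> n div D + card S div K" if "i < q" for i s
      using that assms(3) rk_le by (intro add_mono div_le_mono) auto
    then show ?thesis by (auto simp: key_def E_def)
  qed
  have "inj_on key (E - P)"
  proof (rule inj_onI, clarify)
    fix i b j b'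
    assume h: "(i, b) \<in> E" "(i, b) \<notin> P" "(j, b') \<in> E" "(j, b') \<notin> P" "key (i, b) = key (j, b')"
    have "b = b'" using h(5) by (simp add: key_def)
    moreover have "i = j" using h \<open>b = b'\<close> unfolding P_def
      by (metis (mono_tags, lifting) case_prodI mem_Collect_eq nat_neq_iff)
    ultimately show "i = j \<and> b = b'" by simp
  qed
  then have "card (E - P) \<le> card (B \<times> {..n div D + card S div K})"
    using keyB fin by (intro card_inj_on_le[of key]) auto
  then have EP: "card (E - P) \<le> card B * (n div D + card S div K + 1)"
    using fin by (simp add: card_cartesian_product)
  define Z where "Z = (SIGMA s:S. {s' \<in> S. rk s' div K = rk s div K} \<times> {..<D})"
  have finZ: "finite Z" using fin by (auto simp: Z_def)
  have "card Z = (\<Sum>s\<in>S. card {s' \<in> S. rk s' div K = rk s div K} * D)"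
    unfolding Z_def using fin by (subst card_SigmaI) (auto simp: card_cartesian_product)
  also have "\<dots> \<le> (\<Sum>s\<in>S. K * D)"
    using card_block_le[OF fin(2) pos(2)] by (intro sum_mono mult_right_mono) (auto simp: rk_def)
  finally have cZ: "card Z \<le> card S * (K * D)" by simp
  have "\<forall>e\<in>P. \<exists>j. j > fst e \<and> (j, snd e) \<in> E \<and> key (j, snd e) = key e"
    by (auto simp: P_def)
  then obtain nx where nx: "\<And>e. e \<in> P \<Longrightarrow> nx e > fst e \<and> (nx e, snd e) \<in> E \<and> key (nx e, snd e) = key e"
    by metis
  have blk: "i div D = j div D \<and> rk (f i + b) div K = rk (f j + b) div K"
    if "(i, b) \<in> E" "(j, b) \<in> E" "i < j" "key (j, b) = key (i, b)" for i j b
  proof -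
    have "f i < f j" using that by (intro strict_mono_onD[OF mono]) (auto simp: E_def)
    then have "rk (f i + b) div K \<le> rk (f j + b) div K" by (intro div_le_mono rk_mono) simp
    moreover have "i div D \<le> j div D" using that by (intro div_le_mono) simp
    ultimately show ?thesis using that(4) by (simp add: key_def)
  qed
  define \<phi> where "\<phi> = (\<lambda>e. (f (fst e) + snd e, f (nx e) + snd e, nx e - fst e))"
  have "inj_on \<phi> P"
  proof (rule inj_onI, clarify)
    fix i b i' b' assume h: "(i, b) \<in> P" "(i', b') \<in> P" "\<phi> (i, b) = \<phi> (i', b')"
    define d where "d = nx (i, b) - i"
    have d: "d > 0" "nx (i, b) = i + d" "nx (i', b') = i' + d"
      using nx[OF h(1)] nx[OF h(2)] h(3) by (auto simp: d_def \<phi>_def)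
    have "i \<in> {i. p \<le> i \<and> i + d < q}" "i' \<in> {i. p \<le> i \<and> i + d < q}"
      using nx[OF h(1)] nx[OF h(2)] h(1,2) d by (auto simp: E_def P_def)
    moreover have "f (i + d) - f i = f (i' + d) - f i'"
      using h(3) d by (auto simp: \<phi>_def)
    ultimately have "i = i'" using inj[OF d(1)] by (auto dest: inj_onD)
    then show "i = i' \<and> b = b'" using h(3) by (auto simp: \<phi>_def)
  qed
  moreover have "\<phi> ` P \<subseteq> Z"
  proof (rule image_subsetI)
    fix e assume "e \<in> P"
    then obtain i b where eq: "e = (i, b)" and h: "(i, b) \<in> P" by (cases e) auto
    then have e: "(i, b) \<in> E" by (auto simp: P_def)
    have n: "i < nx (i, b)" "(nx (i, b), b) \<in> E" "key (nx (i, b), b) = key (i, b)"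
      using nx[OF h] by auto
    note k = blk[OF e n(2,1,3)]
    have "nx (i, b) < D * (i div D) + D"
      using k dividend_less_times_div[OF pos(1), of "nx (i, b)"] by simp
    moreover have "D * (i div D) \<le> i" by simp
    ultimately have "nx (i, b) - i < D" using pos by linarith
    then show "\<phi> e \<in> Z" using k e n(2) by (auto simp: eq \<phi>_def Z_def E_def)
  qed
  ultimately have "card P \<le> card S * (K * D)"
    using card_inj_on_le[OF _ _ finZ] cZ by fastforce
  moreover have "card E = card (E - P) + card P"
  proof -
    have "P \<subseteq> E" by (auto simp: P_def)
    then show ?thesis using finE by (metis card_Diff_subset card_mono finite_subset le_add_diff_inverse2)
  qed
  ultimately show ?thesis using EP unfolding E_def by linarith
qed

abbreviation strictly_monotone :: "(nat \<Rightarrow> real) \<Rightarrow> nat \<Rightarrow> nat \<Rightarrow> bool" where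
  "strictly_monotone f p q \<equiv> strict_mono_on {p..<q} f \<or> strict_mono_on {p..<q} (\<lambda>i. - f i)"

text \<open>What the block argument needs from a convex sequence: monotonicity, so that block
  indices move in one direction, and for each gap \<open>d\<close> the recovery of \<open>i\<close>
  from the difference over that gap.\<close>

definition tame :: "(nat \<Rightarrow> real) \<Rightarrow> nat \<Rightarrow> nat \<Rightarrow> bool" where
  "tame f p q \<longleftrightarrow> strictly_monotone f p q \<and>
    (\<forall>d>0. inj_on (\<lambda>i. f (i + d) - f i) {i. p \<le> i \<and> i + d < q})"

lemma tame_inj_on: "tame f p q \<Longrightarrow> inj_on f {p..<q}"
  unfolding tame_def using strict_mono_on_imp_inj_on[of "{p..<q}" f]
    strict_mono_on_imp_inj_on[of "{p..<q}" "\<lambda>i. - f i"] by (auto simp: inj_on_def)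

text \<open>A decreasing \<open>f\<close> becomes increasing when \<open>f\<close>, \<open>B\<close>
  and \<open>S\<close> are all negated, and negation preserves the number of incidences.\<close>

lemma card_incidences_le_blocks_tame:
  fixes f :: "nat \<Rightarrow> real"
  assumes tame: "tame f p q" and "q \<le> n" and fin: "finite B" "finite S" and pos: "D > 0" "K > 0"
  shows "card {(i, b). p \<le> i \<and> i < q \<and> b \<in> B \<and> f i + b \<in> S}
    \<le> card B * (n div D + card S div K + 1) + card S * (K * D)"
proof (cases "strict_mono_on {p..<q} f")
  case True
  then show ?thesis using assms card_incidences_le_blocks[OF True] by (auto simp: tame_def)
next
  case False
  have "inj_on (\<lambda>i. - f (i + d) - - f i) {i. p \<le> i \<and> i + d < q}" if "d > 0" for d
    using tame that unfolding tame_def inj_on_def by fastforce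
  then have "card {(i, b). p \<le> i \<and> i < q \<and> b \<in> uminus ` B \<and> - f i + b \<in> uminus ` S}
    \<le> card (uminus ` B) * (n div D + card (uminus ` S) div K + 1) + card (uminus ` S) * (K * D)"
    using assms False by (intro card_incidences_le_blocks) (auto simp: tame_def)
  moreover have "card {(i, b). p \<le> i \<and> i < q \<and> b \<in> uminus ` B \<and> - f i + b \<in> uminus ` S}
     = card {(i, b). p \<le> i \<and> i < q \<and> b \<in> B \<and> f i + b \<in> S}"
  proof -
    have "{(i, b). p \<le> i \<and> i < q \<and> b \<in> uminus ` B \<and> - f i + b \<in> uminus ` S}
      = (\<lambda>(i, b). (i, - b)) ` {(i, b). p \<le> i \<and> i < q \<and> b \<in> B \<and> f i + b \<in> S}" (is "?L = ?g ` ?R")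
    proof (intro equalityI subsetI)
      fix e assume "e \<in> ?L"
      then obtain i b s where "e = (i, - b)" "p \<le> i" "i < q" "b \<in> B" "s \<in> S" "- f i + - b = - s" by auto
      moreover from this have "f i + b = s" by linarith
      ultimately show "e \<in> ?g ` ?R" by (intro image_eqI[of _ _ "(i, b)"]) auto
    next
      fix e assume "e \<in> ?g ` ?R"
      then obtain i b where "e = (i, - b)" "p \<le> i" "i < q" "b \<in> B" "f i + b \<in> S" by auto
      moreover from this have "- f i + - b \<in> uminus ` S" by (intro image_eqI[of _ _ "f i + b"]) auto
      ultimately show "e \<in> ?L" by blast
    qed
    moreover have "inj_on ?g ?R" by (auto simp: inj_on_def)
    ultimately show ?thesis by (simp add: card_image)
  qed
  ultimately show ?thesis by (simp add: card_image)
qed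

text \<open>A bound of Szemeredi-Trotter strength, obtained by optimising the block sizes. The first
  alternative is the case where the summand \<open>card B\<close> of the block bound may
  dominate.\<close>

lemma incidences_cube_le_tame:
  fixes f :: "nat \<Rightarrow> real"
  assumes tame: "tame f p q" and "q \<le> n" and fin: "finite B" "finite S"
  defines "I \<equiv> card {(i, b). p \<le> i \<and> i < q \<and> b \<in> B \<and> f i + b \<in> S}"
  shows "I \<le> 8 * card B \<or> real I ^ 3 \<le> 130 * real n * real (card B)^2 * real (card S)^2"
proof (cases "I \<le> 8 * card B")
  case False
  define x where "x = real I"
  define \<beta> where "\<beta> = real (card B)"
  define \<sigma> where "\<sigma> = real (card S)"
  define \<nu> where "\<nu> = real n"
  define E where "E = {(i, b). p \<le> i \<and> i < q \<and> b \<in> B \<and> f i + b \<in> S}"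
  have x: "x > 8 * \<beta>" "x > 0" using False by (auto simp: x_def \<beta>_def)
  have nn: "\<beta> \<ge> 0" "\<sigma> \<ge> 0" "\<nu> \<ge> 0" by (auto simp: \<beta>_def \<sigma>_def \<nu>_def)
  have "I \<le> card ({..<n} \<times> B)" unfolding I_def using fin assms(2) by (intro card_mono) auto
  then have I1: "x \<le> \<nu> * \<beta>"
    unfolding card_cartesian_product x_def \<nu>_def \<beta>_def by (simp flip: of_nat_mult)
  have "I \<le> card (S \<times> B)"
    unfolding I_def
  proof (rule card_inj_on_le[of "\<lambda>(i, b). (f i + b, b)"])
    show "inj_on (\<lambda>(i, b). (f i + b, b)) {(i, b). p \<le> i \<and> i < q \<and> b \<in> B \<and> f i + b \<in> S}"
      using inj_onD[OF tame_inj_on[OF tame]] by (fastforce simp: inj_on_def)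
  qed (use fin in auto)
  then have I2: "x \<le> \<sigma> * \<beta>"
    unfolding card_cartesian_product x_def \<sigma>_def \<beta>_def by (simp flip: of_nat_mult)
  \<comment> \<open>With these block sizes each of the three summands counting keys is at most
    \<open>x / 8\<close>, so the consecutive incidences must account for \<open>5/8 * x\<close>. The
    trivial bounds \<open>I1\<close> and \<open>I2\<close> make both quotients at least 8, so
    rounding up only turns the factor 8 into 9.\<close>
  define D where "D = nat \<lceil>8 * \<nu> * \<beta> / x\<rceil>"
  define K where "K = nat \<lceil>8 * \<sigma> * \<beta> / x\<rceil>"
  have D1: "1 \<le> \<nu> * \<beta> / x" and K1: "1 \<le> \<sigma> * \<beta> / x" using I1 I2 x by auto
  have D: "8 * (\<nu> * \<beta> / x) \<le> real D" "real D \<le> 9 * (\<nu> * \<beta> / x)"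
  proof -
    define z where "z = \<nu> * \<beta> / x"
    have z: "1 \<le> z" "8 * \<nu> * \<beta> / x = 8 * z" using D1 by (simp_all add: z_def)
    show "8 * (\<nu> * \<beta> / x) \<le> real D" "real D \<le> 9 * (\<nu> * \<beta> / x)"
      unfolding D_def z(2) z_def[symmetric] using z(1) by linarith+
  qed
  have K: "8 * (\<sigma> * \<beta> / x) \<le> real K" "real K \<le> 9 * (\<sigma> * \<beta> / x)"
  proof -
    define z where "z = \<sigma> * \<beta> / x"
    have z: "1 \<le> z" "8 * \<sigma> * \<beta> / x = 8 * z" using K1 by (simp_all add: z_def)
    show "8 * (\<sigma> * \<beta> / x) \<le> real K" "real K \<le> 9 * (\<sigma> * \<beta> / x)"
      unfolding K_def z(2) z_def[symmetric] using z(1) by linarith+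
  qed
  have pos: "real D > 0" "real K > 0" using D K D1 K1 by linarith+
  have "I \<le> card B * (n div D + card S div K + 1) + card S * (K * D)"
    unfolding I_def using pos by (intro card_incidences_le_blocks_tame[OF tame assms(2) fin]) auto
  then have "x \<le> \<beta> * (real (n div D) + real (card S div K) + 1) + \<sigma> * (real K * real D)"
    unfolding x_def \<beta>_def \<sigma>_def by (metis (no_types, lifting) of_nat_1 of_nat_add of_nat_le_iff of_nat_mult)
  also have "\<dots> \<le> \<beta> * (\<nu> / D + \<sigma> / K + 1) + \<sigma> * (real K * real D)"
    using nn unfolding \<nu>_def \<sigma>_def
    by (intro add_mono mult_left_mono of_nat_div_le_of_nat) auto
  also have "\<dots> \<le> x / 8 + x / 8 + x / 8 + \<sigma> * ((9 * (\<sigma> * \<beta> / x)) * (9 * (\<nu> * \<beta> / x)))"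
  proof -
    have "\<beta> * (\<nu> / D) \<le> x / 8" using D(1) x pos by (simp add: field_simps)
    moreover have "\<beta> * (\<sigma> / K) \<le> x / 8" using K(1) x pos by (simp add: field_simps)
    moreover have "\<sigma> * (real K * real D) \<le> \<sigma> * ((9 * (\<sigma> * \<beta> / x)) * (9 * (\<nu> * \<beta> / x)))"
      using D K nn x by (intro mult_left_mono mult_mono) auto
    ultimately show ?thesis using x unfolding distrib_left by linarith
  qed
  finally have "5/8 * x \<le> 81 * \<nu> * \<beta>^2 * \<sigma>^2 / x^2"
    by (simp add: power2_eq_square field_simps)
  then have "5/8 * x * x^2 \<le> 81 * \<nu> * \<beta>^2 * \<sigma>^2" using x by (simp add: pos_le_divide_eq)
  then have "5/8 * x^3 \<le> 81 * (\<nu> * \<beta>^2 * \<sigma>^2)" by (simp add: power2_eq_square power3_eq_cube)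
  moreover have "0 \<le> \<nu> * \<beta>^2 * \<sigma>^2" using nn by simp
  ultimately have "x^3 \<le> 130 * (\<nu> * \<beta>^2 * \<sigma>^2)" by linarith
  then show ?thesis unfolding x_def \<beta>_def \<sigma>_def \<nu>_def by (simp add: mult.assoc)
qed simp

text \<open>A convex sequence may fall and then rise, so two tame pieces are allowed; either may be
  empty.\<close>

definition piecewise_tame :: "(nat \<Rightarrow> real) \<Rightarrow> nat \<Rightarrow> bool" where
  "piecewise_tame f n \<longleftrightarrow> (\<exists>m\<le>n. tame f 0 m \<and> tame f m n)"

text \<open>One of the two tame pieces carries at least half of the incidences. This doubles the
  constant 8 and multiplies 130 by \<open>2 ^ 3\<close>.\<close>

lemma incidences_cube_le:
  fixes f :: "nat \<Rightarrow> real"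
  assumes "piecewise_tame f n" and fin: "finite B" "finite S"
  defines "I \<equiv> card {(i, b). i < n \<and> b \<in> B \<and> f i + b \<in> S}"
  shows "I \<le> 16 * card B \<or> real I ^ 3 \<le> 1040 * real n * real (card B)^2 * real (card S)^2"
proof -
  obtain m where m: "m \<le> n" "tame f 0 m" "tame f m n"
    using assms(1) by (auto simp: piecewise_tame_def)
  define E where "E p q = {(i, b). p \<le> i \<and> i < q \<and> b \<in> B \<and> f i + b \<in> S}" for p q
  define R where "R = real n * real (card B)^2 * real (card S)^2"
  have "I \<le> card (E 0 m) + card (E m n)"
  proof -
    have "{(i, b). i < n \<and> b \<in> B \<and> f i + b \<in> S} = E 0 m \<union> E m n"
      using m by (auto simp: E_def)
    then show ?thesis unfolding I_def by (simp add: card_Un_le)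
  qed
  then obtain p q where pq: "tame f p q" "q \<le> n" "I \<le> 2 * card (E p q)"
  proof (cases "card (E 0 m) \<le> card (E m n)")
    case True
    then show ?thesis using that[of m n] m \<open>I \<le> card (E 0 m) + card (E m n)\<close> by simp
  next
    case False
    then show ?thesis using that[of 0 m] m \<open>I \<le> card (E 0 m) + card (E m n)\<close> by simp
  qed
  have "card (E p q) \<le> 8 * card B \<or> real (card (E p q)) ^ 3 \<le> 130 * R"
    using incidences_cube_le_tame[OF pq(1,2) fin] by (simp add: E_def R_def mult.assoc)
  then show ?thesis
  proof
    assume "real (card (E p q)) ^ 3 \<le> 130 * R"
    moreover have "real I ^ 3 \<le> (2 * real (card (E p q)))^3" using pq(3) by (intro power_mono) linarith+
    ultimately have "real I ^ 3 \<le> 1040 * R" by (simp add: power_mult_distrib)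
    then show ?thesis by (simp add: R_def mult.assoc)
  qed (use pq(3) in linarith)
qed

lemma card_fibre_le_2:
  assumes "piecewise_tame f n"
  shows "card {i. i < n \<and> f i = y} \<le> 2"
proof -
  obtain m where m: "m \<le> n" "tame f 0 m" "tame f m n"
    using assms(1) by (auto simp: piecewise_tame_def)
  have *: "card {i \<in> {p..<q}. f i = y} \<le> 1" if "tame f p q" for p q
    using tame_inj_on[OF that] by (subst card_le_Suc0_iff_eq[simplified One_nat_def[symmetric]]) (auto simp: inj_on_def)
  have "{i. i < n \<and> f i = y} = {i \<in> {0..<m}. f i = y} \<union> {i \<in> {m..<n}. f i = y}"
    using m by auto
  then show ?thesis using card_Un_le[of "{i \<in> {0..<m}. f i = y}" "{i \<in> {m..<n}. f i = y}"] *[OF m(2)] *[OF m(3)]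
    by simp
qed

section \<open>Sequences with strictly monotone second differences\<close>

lemma strictly_monotone_subinterval:
  "strictly_monotone f p q \<Longrightarrow> p \<le> p' \<Longrightarrow> q' \<le> q \<Longrightarrow> strictly_monotone f p' q'"
  by (metis ivl_subset monotone_on_subset)

lemma strict_mono_on_Suc:
  fixes f :: "nat \<Rightarrow> real"
  assumes "\<And>i. p \<le> i \<Longrightarrow> Suc i < q \<Longrightarrow> f i < f (Suc i)"
  shows "strict_mono_on {p..<q} f"
proof (rule strict_mono_onI)
  fix i j assume h: "i \<in> {p..<q}" "j \<in> {p..<q}" "i < j"
  from h(3) have "Suc i \<le> j" by simp
  then have "j < q \<longrightarrow> f i < f j"
  proof (induction j rule: dec_induct)
    case base
    then show ?case using assms h by auto
  next
    case (step k)
    then show ?case using assms[of k] h by auto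
  qed
  then show "f i < f j" using h by auto
qed

text \<open>By telescoping, a difference over gap \<open>d\<close> is a sum of \<open>d\<close>
  consecutive first differences, each of which grows when the position moves to the right.\<close>

lemma strict_mono_on_shift_diff:
  fixes f :: "nat \<Rightarrow> real"
  assumes "strict_mono_on {p..<q - 1} (\<lambda>i. f (Suc i) - f i)" "d > 0"
  shows "strict_mono_on {p..<q - d} (\<lambda>i. f (i + d) - f i)"
proof (rule strict_mono_onI)
  fix i j assume h: "i \<in> {p..<q - d}" "j \<in> {p..<q - d}" "i < j"
  have tel: "f (k + d) - f k = (\<Sum>t<d. f (Suc (k + t)) - f (k + t))" for k
    by (induction d) auto
  show "f (i + d) - f i < f (j + d) - f j"
    unfolding tel using h assms(2)
    by (intro sum_strict_mono strict_mono_onD[OF assms(1)]) auto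
qed

lemma strictly_monotone_shift_diff:
  fixes f :: "nat \<Rightarrow> real"
  assumes "strictly_monotone (\<lambda>i. f (Suc i) - f i) p (q - 1)" "d > 0"
  shows "strictly_monotone (\<lambda>i. f (i + d) - f i) p (q - d)"
  using assms strict_mono_on_shift_diff[of p q f d] strict_mono_on_shift_diff[of p q "\<lambda>i. - f i" d]
  by auto

lemma tameI:
  assumes "strictly_monotone f p q" "strictly_monotone (\<lambda>i. f (Suc i) - f i) p (q - 1)"
  shows "tame f p q"
  unfolding tame_def
proof (intro conjI allI impI)
  fix d :: nat assume "d > 0"
  from strictly_monotone_shift_diff[OF assms(2) this]
  have "inj_on (\<lambda>i. f (i + d) - f i) {p..<q - d}"
    using strict_mono_on_imp_inj_on[of "{p..<q - d}" "\<lambda>i. f (i + d) - f i"]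
      strict_mono_on_imp_inj_on[of "{p..<q - d}" "\<lambda>i. - (f (i + d) - f i)"] 
    by (auto simp: inj_on_def)
  moreover have "{i. p \<le> i \<and> i + d < q} = {p..<q - d}" by auto
  ultimately show "inj_on (\<lambda>i. f (i + d) - f i) {i. p \<le> i \<and> i + d < q}" by simp
qed (use assms in auto)

text \<open>Increasing first differences change sign at most once, and the cut is made where they
  cease to be negative.\<close>

lemma strictly_monotone_split_mono:
  fixes f :: "nat \<Rightarrow> real"
  assumes g: "strict_mono_on {0..<n - 1} (\<lambda>i. f (Suc i) - f i)"
  shows "\<exists>m\<le>n. strictly_monotone f 0 m \<and> strictly_monotone f m n"
proof (cases "\<exists>i<n - 1. f (Suc i) - f i \<ge> 0")
  case False
  then have "strictly_monotone f 0 n"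
    by (intro disjI2 strict_mono_on_Suc) (auto simp: not_le)
  moreover have "strictly_monotone f n n" by (auto simp: strict_mono_on_def)
  ultimately show ?thesis by blast
next
  case True
  define k where "k = (LEAST i. i < n - 1 \<and> f (Suc i) - f i \<ge> 0)"
  have k: "k < n - 1" "f (Suc k) - f k \<ge> 0"
    using LeastI_ex[of "\<lambda>i. i < n - 1 \<and> f (Suc i) - f i \<ge> 0"] True by (auto simp: k_def)
  have lt: "f (Suc i) - f i < 0" if "i < k" for i
    using not_less_Least[of i "\<lambda>i. i < n - 1 \<and> f (Suc i) - f i \<ge> 0"] that k by (auto simp: k_def)
  have gt: "f (Suc i) - f i > 0" if "i > k" "i < n - 1" for i
    using strict_mono_onD[OF g, of k i] that k by auto
  \<comment> \<open>The cut is placed after \<open>k\<close>, so that the difference from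
    \<open>k\<close> to \<open>Suc k\<close>, which may be zero, lies in neither piece.\<close>
  have "strictly_monotone f 0 (Suc k)"
    using lt by (intro disjI2 strict_mono_on_Suc) auto
  moreover have "strictly_monotone f (Suc k) n"
    using gt by (intro disjI1 strict_mono_on_Suc) (metis Suc_le_lessD diff_gt_0_iff_gt less_diff_conv Suc_eq_plus1)
  moreover have "Suc k \<le> n" using k by auto
  ultimately show ?thesis by blast
qed

lemma strictly_monotone_split:
  fixes f :: "nat \<Rightarrow> real"
  assumes "strictly_monotone (\<lambda>i. f (Suc i) - f i) 0 (n - 1)"
  shows "\<exists>m\<le>n. strictly_monotone f 0 m \<and> strictly_monotone f m n"
proof (cases "strict_mono_on {0..<n - 1} (\<lambda>i. f (Suc i) - f i)")
  case True
  then show ?thesis by (rule strictly_monotone_split_mono)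
next
  case False
  then have "strict_mono_on {0..<n - 1} (\<lambda>i. - f (Suc i) - - f i)" using assms by simp
  from strictly_monotone_split_mono[OF this] show ?thesis by auto
qed

text \<open>The indexed form of the increasing enumeration of a 2-convex set with \<open>n\<close>
  elements. A second difference at \<open>i\<close> involves \<open>i + 2\<close>, hence the range
  up to \<open>n - 2\<close>.\<close>

definition convex2_on :: "(nat \<Rightarrow> real) \<Rightarrow> nat \<Rightarrow> bool" where
  "convex2_on a n \<longleftrightarrow> strict_mono_on {0..<n} a \<and>
    strictly_monotone (\<lambda>i. (a (Suc (Suc i)) - a (Suc i)) - (a (Suc i) - a i)) 0 (n - 2)"

text \<open>The second differences are monotone but may change sign, so the first differences turn
  at most once; cutting there leaves two pieces on which they are monotone.\<close>

lemma piecewise_tame_convex2: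
  assumes "convex2_on a n"
  shows "piecewise_tame a n"
proof -
  let ?g = "\<lambda>i. a (Suc i) - a i"
  have mono: "strictly_monotone a 0 n" using assms by (auto simp: convex2_on_def)
  have "strictly_monotone (\<lambda>i. ?g (Suc i) - ?g i) 0 ((n - 1) - 1)"
    using assms by (simp add: convex2_on_def numeral_2_eq_2)
  from strictly_monotone_split[OF this] obtain m where
    m: "m \<le> n - 1" "strictly_monotone ?g 0 m" "strictly_monotone ?g m (n - 1)" by blast
  have "tame a 0 m"
    using m(1) by (intro tameI strictly_monotone_subinterval[OF m(2)] strictly_monotone_subinterval[OF mono]) auto
  moreover have "tame a m n"
    using m(1) by (intro tameI m(3) strictly_monotone_subinterval[OF mono]) auto
  ultimately show ?thesis using m(1) unfolding piecewise_tame_def by (meson diff_le_self order_trans)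
qed

text \<open>The point where 2-convexity is essential: the first difference of
  \<open>a (i + d) - a i\<close> is the difference over gap \<open>d\<close> of the first
  differences of \<open>a\<close>, hence monotone by telescoping second differences. The shifted
  difference is thus convex or concave and is cut at its turning point.\<close>

lemma piecewise_tame_shift_diff:
  assumes "convex2_on a n" "d > 0"
  shows "piecewise_tame (\<lambda>i. a (i + d) - a i) (n - d)"
proof -
  let ?g = "\<lambda>i. a (Suc i) - a i" and ?f = "\<lambda>i. a (i + d) - a i"
  have "strictly_monotone (\<lambda>i. ?g (Suc i) - ?g i) 0 ((n - 1) - 1)"
    using assms by (simp add: convex2_on_def numeral_2_eq_2)
  from strictly_monotone_shift_diff[OF this assms(2)]
  have g: "strictly_monotone (\<lambda>i. ?f (Suc i) - ?f i) 0 ((n - d) - 1)"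
    by (simp add: algebra_simps)
  from strictly_monotone_split[OF g] obtain m where
    m: "m \<le> n - d" "strictly_monotone ?f 0 m" "strictly_monotone ?f m (n - d)" by blast
  have "tame ?f 0 m" "tame ?f m (n - d)"
    using m by (intro tameI m strictly_monotone_subinterval[OF g]; simp)+
  then show ?thesis using m(1) unfolding piecewise_tame_def by blast
qed

section \<open>From 2-convex sets to indexed sequences\<close>

lemma nth_diffs: "i + 1 < length xs \<Longrightarrow> diffs xs ! i = xs ! (i + 1) - xs ! i"
  by (simp add: diffs_def nth_tl)

lemma length_diffs: "length (diffs xs) = length xs - 1"
  by (simp add: diffs_def)

lemma convex_set_2_enumeration:
  assumes "convex_set 2 A"
  obtains a where "convex2_on a (card A)" "bij_betw a {..<card A} A"
proof -
  define xs where "xs = sorted_list_of_set A"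
  have fin: "finite A" and "convex_seq 2 xs" using assms by (auto simp: convex_set_def xs_def)
  then have sorted: "sorted_wrt (<) (diffs (diffs xs)) \<or> sorted_wrt (>) (diffs (diffs xs))"
    by (simp add: numeral_2_eq_2)
  have len: "length xs = card A" by (simp add: xs_def)
  let ?h = "\<lambda>i. (xs ! Suc (Suc i) - xs ! Suc i) - (xs ! Suc i - xs ! i)"
  have nth: "diffs (diffs xs) ! i = ?h i" if "i < card A - 2" for i
    using that len by (simp add: nth_diffs length_diffs)
  have "strictly_monotone ?h 0 (card A - 2)"
    using sorted
  proof
    assume "sorted_wrt (<) (diffs (diffs xs))"
    then have "strict_mono_on {0..<card A - 2} ?h"
      by (intro strict_mono_onI, subst (1 2) nth[symmetric])
        (auto simp: sorted_wrt_iff_nth_less length_diffs len)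
    then show ?thesis by blast
  next
    assume "sorted_wrt (>) (diffs (diffs xs))"
    then have "strict_mono_on {0..<card A - 2} (\<lambda>i. - ?h i)"
      by (intro strict_mono_onI, subst (1 2) nth[symmetric])
        (auto simp: sorted_wrt_iff_nth_less length_diffs len)
    then show ?thesis by blast
  qed
  moreover have "sorted_wrt (<) xs" by (simp add: xs_def)
  then have "strict_mono_on {0..<card A} ((!) xs)"
    by (auto simp: sorted_wrt_iff_nth_less strict_mono_on_def len)
  ultimately have "convex2_on ((!) xs) (card A)" by (simp add: convex2_on_def)
  moreover have "bij_betw ((!) xs) {..<card A} A"
    using fin len by (intro bij_betw_nth) (auto simp: xs_def)
  ultimately show ?thesis by (rule that)
qed

section \<open>Pairs of nearby solutions\<close>

lemma card_UN_le_mult: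
  assumes "finite I" "\<And>i. i \<in> I \<Longrightarrow> card (F i) \<le> m"
  shows "card (\<Union>i\<in>I. F i) \<le> card I * m"
  using card_UN_le[OF assms(1), of F] sum_bounded_above[of I "\<lambda>i. card (F i)" m] assms(2) by simp

lemma powr_five_thirds_cubed:
  assumes "(x :: real) > 0"
  shows "(x powr (5/3)) ^ 3 = x ^ 5"
proof -
  have "(x powr (5/3)) ^ 3 = (x powr (5/3)) powr real 3"
    using assms by (intro powr_realpow[symmetric]) simp
  also have "\<dots> = x powr real 5" unfolding powr_powr by simp
  also have "\<dots> = x ^ 5" using assms by (rule powr_realpow)
  finally show ?thesis .
qed

text \<open>A zero sum is an incidence of \<open>u\<close> with the scaled values of
  \<open>v\<close> and the negated scaled values of \<open>w\<close>. Each value of \<open>v\<close>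
  or \<open>w\<close> is taken at most twice, so an incidence comes from at most four triples. The
  cubed form avoids the exponent \<open>5/3\<close>.\<close>

lemma card_zero_sums_cube_le:
  assumes tame: "piecewise_tame u n1" "piecewise_tame v n2" "piecewise_tame w n3"
    and le: "n1 \<le> N" "n2 \<le> N" "n3 \<le> N" and nz: "s \<noteq> 0" "t \<noteq> 0"
  shows "real (card {(i, j, k). i < n1 \<and> j < n2 \<and> k < n3 \<and> u i + s * v j + t * w k = 0}) ^ 3
    \<le> 64 ^ 3 * real N ^ 5"
proof -
  define T where "T = {(i, j, k). i < n1 \<and> j < n2 \<and> k < n3 \<and> u i + s * v j + t * w k = 0}"
  define B where "B = (\<lambda>j. s * v j) ` {..<n2}"
  define S where "S = (\<lambda>k. - (t * w k)) ` {..<n3}"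
  define E where "E = {(i, b). i < n1 \<and> b \<in> B \<and> u i + b \<in> S}"
  have fin: "finite B" "finite S" by (auto simp: B_def S_def)
  have cB: "card B \<le> N" and cS: "card S \<le> N"
    using le card_image_le[of "{..<n2}" "\<lambda>j. s * v j"] card_image_le[of "{..<n3}" "\<lambda>k. - (t * w k)"]
    by (auto simp: B_def S_def)
  have finE: "finite E" by (rule finite_subset[of _ "{..<n1} \<times> B"]) (use fin in \<open>auto simp: E_def\<close>)
  define F where "F = (\<lambda>(i, b). {i} \<times> ({j. j < n2 \<and> v j = b / s} \<times> {k. k < n3 \<and> w k = - (u i + b) / t}))"
  have "T \<subseteq> (\<Union>e\<in>E. F e)"
  proof clarify
    fix i j k assume "(i, j, k) \<in> T"
    then have h: "i < n1" "j < n2" "k < n3" "u i + s * v j = - (t * w k)" by (auto simp: T_def)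
    then have "(i, s * v j) \<in> E" by (auto simp: E_def B_def S_def)
    moreover have "w k * t = - (u i + s * v j)" using h(4) by (simp add: mult.commute)
    then have "w k = - (u i + s * v j) / t" by (rule eq_divide_imp[OF nz(2)])
    then have "(i, j, k) \<in> F (i, s * v j)" using h(1-3) nz by (simp add: F_def)
    ultimately show "(i, j, k) \<in> (\<Union>e\<in>E. F e)" by blast
  qed
  moreover have "finite (\<Union>e\<in>E. F e)" using finE by (auto simp: F_def)
  ultimately have "card T \<le> card (\<Union>e\<in>E. F e)" by (rule card_mono[rotated])
  also have "\<dots> \<le> card E * 4"
  proof (rule card_UN_le_mult[OF finE], clarify)
    fix i b
    show "card (F (i, b)) \<le> 4"
      using mult_le_mono[OF card_fibre_le_2[OF tame(2), of "b / s"] card_fibre_le_2[OF tame(3), of "- (u i + b) / t"]]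
      by (simp add: F_def card_cartesian_product)
  qed
  finally have cT: "real (card T) \<le> 4 * real (card E)" by simp
  \<comment> \<open>The constant \<open>16 ^ 3\<close> covers both alternatives of the incidence
    bound, since it exceeds 1040 and \<open>N ^ 3\<close> is at most \<open>N ^ 5\<close>.\<close>
  have "real (card E) ^ 3 \<le> 16 ^ 3 * real N ^ 5"
    using incidences_cube_le[OF tame(1) fin, folded E_def]
  proof
    assume "card E \<le> 16 * card B"
    then have "real (card E) \<le> 16 * real N" using cB by linarith
    then have "real (card E) ^ 3 \<le> (16 * real N) ^ 3" by (intro power_mono) auto
    also have "\<dots> = 16 ^ 3 * real N ^ 3" by (simp add: power_mult_distrib)
    also have "real N ^ 3 \<le> real N ^ 5" by (cases "N = 0") (auto intro: power_increasing)
    finally show ?thesis by simp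
  next
    assume "real (card E) ^ 3 \<le> 1040 * real n1 * real (card B)^2 * real (card S)^2"
    also have "\<dots> \<le> 1040 * real N * real N ^ 2 * real N ^ 2"
      using cB cS le by (intro mult_mono power_mono) auto
    also have "\<dots> = 1040 * real N ^ 5" by (simp add: power_numeral_reduce)
    also have "\<dots> \<le> 16 ^ 3 * real N ^ 5" by simp
    finally show ?thesis .
  qed
  then have "(4 * real (card E)) ^ 3 \<le> 64 ^ 3 * real N ^ 5" by (simp add: power_mult_distrib)
  moreover have "real (card T) ^ 3 \<le> (4 * real (card E)) ^ 3" using cT by (intro power_mono) auto
  ultimately show ?thesis unfolding T_def by linarith
qed

text \<open>Booleans stand for signs so that the sign patterns form a finite type to sum
  over.\<close>

definition bool_sgn :: "bool \<Rightarrow> real" where "bool_sgn s = (if s then 1 else - 1)"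

lemma bool_sgn_nonzero [simp]: "bool_sgn s \<noteq> 0" by (simp add: bool_sgn_def)

lemma bool_sgn_square [simp]: "bool_sgn s * bool_sgn s = 1" by (simp add: bool_sgn_def)

text \<open>Here \<open>i0\<close> is the smaller of the two indices, \<open>d\<close> their gap,
  and \<open>s\<close> records whether \<open>i\<close> is the smaller one. The orientation is kept
  so that \<open>i\<close> can be recovered from \<open>i0\<close>.\<close>

lemma same_block_step:
  fixes a :: "nat \<Rightarrow> real"
  assumes "i < N" "i' < N" "i \<noteq> i'" "i div L = i' div L" "L > 0"
  obtains s d i0 where "d \<in> {1..<L}" "i0 < N - d" "i = (if s then i0 else i0 + d)"
    "a i' - a i = bool_sgn s * (a (i0 + d) - a i0)"
proof -
  have *: "q - p \<in> {1..<L}" "q = p + (q - p)" if "p < q" "p div L = q div L" for p q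
  proof -
    have "q < L * (p div L) + L"
      using that(2) dividend_less_times_div[OF assms(5), of q] by simp
    moreover have "L * (p div L) \<le> p" by simp
    ultimately have "q - p < L" using that(1) assms(5) by linarith
    then show "q - p \<in> {1..<L}" "q = p + (q - p)" using that(1) by auto
  qed
  show ?thesis
  proof (cases "i < i'")
    case True
    then show ?thesis using *[OF True] assms by (intro that[of "i' - i" i True]) (auto simp: bool_sgn_def)
  next
    case False
    then have "i' < i" using assms by simp
    then show ?thesis using *[of i' i] assms by (intro that[of "i - i'" i' False]) (auto simp: bool_sgn_def)
  qed
qed

text \<open>Three gaps below \<open>L\<close> and three orientations turn such a triple into a zero
  sum of shifted differences. There are at most \<open>8 * L ^ 3\<close> choices of gaps and
  orientations, each with at most \<open>64 * N powr (5/3)\<close> zero sums.\<close>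

lemma card_generic_pairs_le:
  assumes conv: "convex2_on a N" "convex2_on b N" "convex2_on c N" and L: "L > 0"
  shows "real (card {(i, j, k). i < N \<and> j < N \<and> k < N \<and>
      (\<exists>i' j' k'. i' < N \<and> j' < N \<and> k' < N \<and> i \<noteq> i' \<and> j \<noteq> j' \<and> k \<noteq> k' \<and>
        i div L = i' div L \<and> j div L = j' div L \<and> k div L = k' div L \<and>
        a i + b j + c k = a i' + b j' + c k')}) \<le> 512 * real L ^ 3 * real N powr (5/3)"
    (is "real (card ?Z) \<le> _")
proof -
  define Sol where "Sol = (\<lambda>((s1, s2, s3), (d, e, f)). {(i, j, k). i < N - d \<and> j < N - e \<and> k < N - f \<and>
    (a (i + d) - a i) + bool_sgn s1 * bool_sgn s2 * (b (j + e) - b j) + bool_sgn s1 * bool_sgn s3 * (c (k + f) - c k) = 0})"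
  define h where "h = (\<lambda>((s1, s2, s3), (d, e, f)) (i, j, k).
    (if s1 then i else i + d :: nat, if s2 then j else j + e :: nat, if s3 then k else k + f :: nat))"
  define I where "I = (UNIV :: (bool \<times> bool \<times> bool) set) \<times> ({1..<L} \<times> {1..<L} \<times> {1..<L})"
  have finSol: "finite (Sol x)" for x
    by (rule finite_subset[of _ "{..<N} \<times> {..<N} \<times> {..<N}"]) (auto simp: Sol_def split: prod.splits)
  have "?Z \<subseteq> (\<Union>x\<in>I. h x ` Sol x)"
  proof clarify
    fix i j k i' j' k'
    assume lt: "i < N" "j < N" "k < N" "i' < N" "j' < N" "k' < N"
      and ne: "i \<noteq> i'" "j \<noteq> j'" "k \<noteq> k'"
      and bl: "i div L = i' div L" "j div L = j' div L" "k div L = k' div L"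
      and eq: "a i + b j + c k = a i' + b j' + c k'"
    obtain s1 d i0 where 1: "d \<in> {1..<L}" "i0 < N - d" "i = (if s1 then i0 else i0 + d)"
        "a i' - a i = bool_sgn s1 * (a (i0 + d) - a i0)"
      using same_block_step[OF lt(1,4) ne(1) bl(1) L] .
    obtain s2 e j0 where 2: "e \<in> {1..<L}" "j0 < N - e" "j = (if s2 then j0 else j0 + e)"
        "b j' - b j = bool_sgn s2 * (b (j0 + e) - b j0)"
      using same_block_step[OF lt(2,5) ne(2) bl(2) L] .
    obtain s3 f k0 where 3: "f \<in> {1..<L}" "k0 < N - f" "k = (if s3 then k0 else k0 + f)"
        "c k' - c k = bool_sgn s3 * (c (k0 + f) - c k0)"
      using same_block_step[OF lt(3,6) ne(3) bl(3) L] .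
    \<comment> \<open>Multiplying by the first sign makes the first coefficient 1, as the count of
      zero sums requires.\<close>
    have "bool_sgn s1 * ((a i' - a i) + (b j' - b j) + (c k' - c k)) = 0" using eq by simp
    then have "(a (i0 + d) - a i0) + bool_sgn s1 * bool_sgn s2 * (b (j0 + e) - b j0) + bool_sgn s1 * bool_sgn s3 * (c (k0 + f) - c k0) = 0"
      unfolding 1(4) 2(4) 3(4) distrib_left mult.assoc[symmetric] by simp
    then have "(i0, j0, k0) \<in> Sol ((s1, s2, s3), (d, e, f))" using 1 2 3 by (simp add: Sol_def)
    moreover have "(i, j, k) = h ((s1, s2, s3), (d, e, f)) (i0, j0, k0)" using 1 2 3 by (simp add: h_def)
    moreover have "((s1, s2, s3), (d, e, f)) \<in> I" using 1 2 3 by (simp add: I_def)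
    ultimately show "(i, j, k) \<in> (\<Union>x\<in>I. h x ` Sol x)" by blast
  qed
  then have "card ?Z \<le> card (\<Union>x\<in>I. h x ` Sol x)"
    by (rule card_mono[rotated]) (auto simp: I_def finSol)
  also have "\<dots> \<le> (\<Sum>x\<in>I. card (h x ` Sol x))" by (rule card_UN_le) (simp add: I_def)
  finally have "real (card ?Z) \<le> (\<Sum>x\<in>I. real (card (h x ` Sol x)))" by (simp flip: of_nat_sum)
  also have "\<dots> \<le> (\<Sum>x\<in>I. 64 * real N powr (5/3))"
  proof (rule sum_mono)
    fix x assume "x \<in> I"
    then obtain s1 s2 s3 d e f where x: "x = ((s1, s2, s3), (d, e, f))" "d > 0" "e > 0" "f > 0"
      by (auto simp: I_def)
    have "real (card (Sol x)) ^ 3 \<le> 64 ^ 3 * real N ^ 5"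
      unfolding Sol_def x prod.case
      by (intro card_zero_sums_cube_le piecewise_tame_shift_diff conv x) auto
    also have "\<dots> = (64 * real N powr (5/3)) ^ 3"
      by (cases "N = 0") (simp_all add: power_mult_distrib powr_five_thirds_cubed)
    finally have "real (card (Sol x)) \<le> 64 * real N powr (5/3)"
      by (subst (asm) power_mono_iff) simp_all
    moreover have "card (h x ` Sol x) \<le> card (Sol x)" by (rule card_image_le[OF finSol])
    ultimately show "real (card (h x ` Sol x)) \<le> 64 * real N powr (5/3)" by linarith
  qed
  also have "\<dots> = real (card I) * (64 * real N powr (5/3))" by simp
  also have "\<dots> \<le> (8 * real L ^ 3) * (64 * real N powr (5/3))"
  proof (rule mult_right_mono)
    have "card I = 8 * (L - 1) ^ 3"
      by (simp add: I_def card_cartesian_product card_UNIV_bool power3_eq_cube flip: UNIV_Times_UNIV)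
    also have "\<dots> \<le> 8 * L ^ 3" by (simp add: power_mono)
    finally show "real (card I) \<le> 8 * real L ^ 3" by (simp flip: of_nat_power of_nat_mult add: of_nat_le_iff del: of_nat_power of_nat_mult)
  qed simp
  finally show ?thesis by simp
qed

text \<open>For \<open>x = a i + b j + c k\<close> with partner \<open>(i, j', k')\<close>, the pair \<open>(j, k)\<close> lies in the following set.\<close>

definition close_pairs :: "(nat \<Rightarrow> real) \<Rightarrow> (nat \<Rightarrow> real) \<Rightarrow> nat \<Rightarrow> nat \<Rightarrow> (nat \<times> nat) set" where
  "close_pairs b c N L = {(j, k). j < N \<and> k < N \<and> (\<exists>j' k'. j' < N \<and> k' < N \<and> (j, k) \<noteq> (j', k') \<and>
     j div L = j' div L \<and> k div L = k' div L \<and> b j + c k = b j' + c k')}"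

text \<open>For fixed gaps and orientations, \<open>j\<close> determines the value of the shifted
  difference of \<open>c\<close>, which is attained for at most two \<open>k\<close>. With at most
  \<open>4 * L ^ 2\<close> choices of gaps and orientations this gives the factor 8.\<close>

lemma card_close_pairs_le:
  assumes conv: "convex2_on b N" "convex2_on c N" and L: "L > 0"
  shows "card (close_pairs b c N L) \<le> 8 * L ^ 2 * N"
proof -
  define Sol where "Sol = (\<lambda>((s2, s3), (e, f)). {(j, k). j < N - e \<and> k < N - f \<and>
    bool_sgn s2 * (b (j + e) - b j) + bool_sgn s3 * (c (k + f) - c k) = 0})"
  define h where "h = (\<lambda>((s2, s3), (e, f)) (j, k).
    (if s2 then j else j + e :: nat, if s3 then k else k + f :: nat))"
  define I where "I = (UNIV :: (bool \<times> bool) set) \<times> ({1..<L} \<times> {1..<L})"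
  have injb: "inj_on b {0..<N}" and injc: "inj_on c {0..<N}"
    using conv by (auto simp: convex2_on_def intro: strict_mono_on_imp_inj_on)
  have finSol: "finite (Sol x)" for x
    by (rule finite_subset[of _ "{..<N} \<times> {..<N}"]) (auto simp: Sol_def split: prod.splits)
  have "close_pairs b c N L \<subseteq> (\<Union>x\<in>I. h x ` Sol x)"
  proof (rule subsetI)
    fix p assume "p \<in> close_pairs b c N L"
    then obtain j k j' k' where p: "p = (j, k)"
      and lt: "j < N" "k < N" "j' < N" "k' < N"
      and ne: "(j, k) \<noteq> (j', k')"
      and bl: "j div L = j' div L" "k div L = k' div L"
      and eq: "b j + c k = b j' + c k'"
      unfolding close_pairs_def by blast
    \<comment> \<open>If one coordinate agreed, the equation and injectivity would force the other
      to agree as well.\<close>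
    have ne': "j \<noteq> j'" "k \<noteq> k'"
      using ne eq lt inj_onD[OF injb, of j j'] inj_onD[OF injc, of k k'] by auto
    obtain s2 e j0 where 2: "e \<in> {1..<L}" "j0 < N - e" "j = (if s2 then j0 else j0 + e)"
        "b j' - b j = bool_sgn s2 * (b (j0 + e) - b j0)"
      using same_block_step[OF lt(1,3) ne'(1) bl(1) L] .
    obtain s3 f k0 where 3: "f \<in> {1..<L}" "k0 < N - f" "k = (if s3 then k0 else k0 + f)"
        "c k' - c k = bool_sgn s3 * (c (k0 + f) - c k0)"
      using same_block_step[OF lt(2,4) ne'(2) bl(2) L] .
    have "(b j' - b j) + (c k' - c k) = 0" using eq by simp
    then have "(j0, k0) \<in> Sol ((s2, s3), (e, f))" unfolding 2(4) 3(4) using 2 3 by (simp add: Sol_def)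
    moreover have "(j, k) = h ((s2, s3), (e, f)) (j0, k0)" using 2 3 by (simp add: h_def)
    moreover have "((s2, s3), (e, f)) \<in> I" using 2 3 by (simp add: I_def)
    ultimately show "p \<in> (\<Union>x\<in>I. h x ` Sol x)" unfolding p by blast
  qed
  then have "card (close_pairs b c N L) \<le> card (\<Union>x\<in>I. h x ` Sol x)"
    by (rule card_mono[rotated]) (auto simp: I_def finSol)
  also have "\<dots> \<le> card I * (N * 2)"
  proof (rule card_UN_le_mult)
    fix x assume "x \<in> I"
    then obtain s2 s3 e f where x: "x = ((s2, s3), (e, f))" "e > 0" "f > 0"
      by (auto simp: I_def)
    define y where "y j = - (bool_sgn s2 * (b (j + e) - b j)) / bool_sgn s3" for j
    have "Sol x \<subseteq> (\<Union>j<N. {j} \<times> {k. k < N - f \<and> c (k + f) - c k = y j})"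
      unfolding Sol_def x y_def by (auto simp: field_simps)
    then have "card (Sol x) \<le> card (\<Union>j<N. {j} \<times> {k. k < N - f \<and> c (k + f) - c k = y j})"
      by (rule card_mono[rotated]) auto
    also have "\<dots> \<le> card {..<N} * 2"
      by (rule card_UN_le_mult)
        (auto simp: card_cartesian_product intro!: card_fibre_le_2 piecewise_tame_shift_diff conv x)
    finally show "card (h x ` Sol x) \<le> N * 2"
      using card_image_le[OF finSol, of "h x" x] by simp
  qed (simp add: I_def)
  also have "card I = 4 * (L - 1) ^ 2"
    by (simp add: I_def card_cartesian_product card_UNIV_bool power2_eq_square flip: UNIV_Times_UNIV)
  also have "4 * (L - 1) ^ 2 * (N * 2) \<le> 8 * L ^ 2 * N"
    by (simp add: power_mono)
  finally show ?thesis .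
qed

section \<open>Solutions sharing a coordinate\<close>

text \<open>Split off the values in \<open>[t, 2 * t)\<close> and induct on the number of doublings
  needed to pass all values. The second condition on \<open>C\<close> is precisely what closes this
  induction: it says that \<open>C\<close> dominates the geometric series with ratio
  \<open>2 powr (q - p)\<close>.\<close>

lemma dyadic_sum_le:
  fixes w :: "'a \<Rightarrow> real"
  assumes fin: "finite Q" and T: "T > 0" and K: "K \<ge> 0" and q: "q \<ge> 0"
    and level: "\<And>t. t \<ge> T \<Longrightarrow> real (card {x \<in> Q. t \<le> w x \<and> w x < 2 * t}) \<le> K * t powr (- p)"
    and C: "C \<ge> 0" "2 powr q + C * 2 powr (q - p) \<le> C"
  shows "(\<Sum>x\<in>{x \<in> Q. T \<le> w x}. w x powr q) \<le> C * K * T powr (q - p)"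
proof -
  have ind: "(\<Sum>x\<in>{x \<in> Q. t \<le> w x}. w x powr q) \<le> C * K * t powr (q - p)"
    if "t \<ge> T" "\<And>x. x \<in> Q \<Longrightarrow> w x < 2 ^ n * t" for t n
    using that
  proof (induction n arbitrary: t)
    case 0
    then have "{x \<in> Q. t \<le> w x} = {}" by force
    then have "(\<Sum>x\<in>{x \<in> Q. t \<le> w x}. w x powr q) = 0" by (simp only: sum.empty)
    then show ?case using C K by simp
  next
    case (Suc n)
    have t: "t > 0" using Suc.prems T by simp
    let ?A = "{x \<in> Q. t \<le> w x \<and> w x < 2 * t}" and ?B = "{x \<in> Q. 2 * t \<le> w x}"
    have "{x \<in> Q. t \<le> w x} = ?A \<union> ?B" using t by auto
    then have "(\<Sum>x\<in>{x \<in> Q. t \<le> w x}. w x powr q) = (\<Sum>x\<in>?A. w x powr q) + (\<Sum>x\<in>?B. w x powr q)"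
      using fin by (simp only:) (subst sum.union_disjoint, auto)
    also have "(\<Sum>x\<in>?B. w x powr q) \<le> C * K * (2 * t) powr (q - p)"
      using Suc.prems t by (intro Suc.IH) (auto simp: mult_ac)
    also have "(\<Sum>x\<in>?A. w x powr q) \<le> real (card ?A) * (2 * t) powr q"
      using t q by (intro sum_bounded_above powr_mono2) auto
    also have "\<dots> \<le> (K * t powr (- p)) * (2 * t) powr q"
      using level[OF Suc.prems(1)] by (intro mult_right_mono) auto
    also have "(K * t powr (- p)) * (2 * t) powr q + C * K * (2 * t) powr (q - p)
        = K * t powr (q - p) * (2 powr q + C * 2 powr (q - p))"
    proof -
      have "t powr (- p) * t powr q = t powr (q - p)" by (simp flip: powr_add)
      then show ?thesis using t by (simp add: powr_mult algebra_simps)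
    qed
    also have "\<dots> \<le> K * t powr (q - p) * C"
      using C K by (intro mult_left_mono) auto
    finally show ?case by (simp add: mult_ac)
  qed
  \<comment> \<open>The values of \<open>w\<close> on the finite set \<open>Q\<close> are bounded,
    so finitely many doublings of \<open>T\<close> exceed them all.\<close>
  define W where "W = Max (insert 0 (w ` Q))"
  obtain n where n: "W / T < 2 ^ n" using real_arch_pow[of 2 "W / T"] by auto
  have "w x < 2 ^ n * T" if "x \<in> Q" for x
  proof -
    have "w x \<le> W" unfolding W_def using fin that by (intro Max_ge) auto
    also have "W < 2 ^ n * T" using n T by (simp add: divide_less_eq)
    finally show ?thesis .
  qed
  then show ?thesis by (intro ind[of T n]) auto
qed

text \<open>The sums \<open>y = b j + c k\<close> with many \<open>i\<close> such that \<open>a i + y \<in> X\<close> are few by the incidence bound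
  for \<open>a\<close>, and they carry few pairs \<open>(j, k)\<close> by the incidence bound for \<open>b\<close>.\<close>

lemma card_rich_pairs_cube_le:
  assumes tame: "piecewise_tame a N" "piecewise_tame b N" and inj: "inj_on c {..<N}"
    and fin: "finite X" and Q: "Q \<subseteq> {..<N} \<times> {..<N}" and t: "t > 16"
  shows "(t ^ 2 * real (card {(j, k) \<in> Q. t \<le> real (card {i. i < N \<and> a i + (b j + c k) \<in> X})})) ^ 3
    \<le> 1648 ^ 3 * real N ^ 5 * real (card X) ^ 4"
proof -
  define w where "w y = real (card {i. i < N \<and> a i + y \<in> X})" for y
  define H where "H = {(j, k) \<in> Q. t \<le> w (b j + c k)}"
  define W where "W = {y \<in> (\<lambda>(j, k). b j + c k) ` Q. t \<le> w y}"
  have finQ: "finite Q" using Q by (rule finite_subset) auto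
  then have finW: "finite W" by (simp add: W_def)
  show ?thesis
  proof (cases "W = {}")
    case True
    then have "H = {}" by (force simp: W_def H_def)
    then have "(t ^ 2 * real (card H)) ^ 3 \<le> 1648 ^ 3 * real N ^ 5 * real (card X) ^ 4" by simp
    then show ?thesis unfolding H_def w_def .
  next
    case False
    then have W1: "real (card W) \<ge> 1" using finW by (simp add: Suc_leI card_gt_0_iff)
    define E where "E = {(i, y). i < N \<and> y \<in> W \<and> a i + y \<in> X}"
    have "E = (\<lambda>(y, i). (i, y)) ` (SIGMA y:W. {i. i < N \<and> a i + y \<in> X})"
      by (auto simp: E_def)
    then have "card E = card (SIGMA y:W. {i. i < N \<and> a i + y \<in> X})"
      by (simp add: card_image inj_on_def)
    also have "\<dots> = (\<Sum>y\<in>W. card {i. i < N \<and> a i + y \<in> X})"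
      using finW by (intro card_SigmaI) auto
    finally have "real (card E) = (\<Sum>y\<in>W. w y)" by (simp add: w_def)
    moreover have "(\<Sum>y\<in>W. w y) \<ge> (\<Sum>y\<in>W. t)" by (intro sum_mono) (auto simp: W_def)
    ultimately have tW: "t * real (card W) \<le> real (card E)" by (simp add: mult.commute)
    have "t ^ 3 * real (card W) \<le> 1040 * real N * real (card X) ^ 2"
      using incidences_cube_le[OF tame(1) finW fin, folded E_def]
    proof
      \<comment> \<open>This alternative is contradictory: \<open>W\<close> is nonempty and each of
        its elements carries at least \<open>t > 16\<close> incidences.\<close>
      assume "card E \<le> 16 * card W"
      then have "t * real (card W) \<le> 16 * real (card W)" using tW by linarith
      then show ?thesis using t W1 by simp
    next
      assume "real (card E) ^ 3 \<le> 1040 * real N * (real (card W))\<^sup>2 * (real (card X))\<^sup>2"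
      moreover have "(t * real (card W)) ^ 3 \<le> real (card E) ^ 3"
        using tW t by (intro power_mono) auto
      ultimately have "(t ^ 3 * real (card W)) * real (card W) ^ 2 \<le> (1040 * real N * real (card X) ^ 2) * real (card W) ^ 2"
        by (simp add: power_mult_distrib power2_eq_square power3_eq_cube mult_ac)
      then show ?thesis using W1 by (subst (asm) mult_le_cancel_right_pos) auto
    qed
    then have "(t ^ 3 * real (card W)) ^ 2 \<le> (1040 * real N * real (card X) ^ 2) ^ 2"
      using t by (intro power_mono) auto
    then have A: "t ^ 6 * real (card W) ^ 2 \<le> 1040 ^ 2 * real N ^ 2 * real (card X) ^ 4"
      by (simp add: power_mult_distrib flip: power_mult)
    define G where "G = {(j, v). j < N \<and> v \<in> c ` {..<N} \<and> b j + v \<in> W}"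
    have cc: "card (c ` {..<N}) = N" using inj by (simp add: card_image)
    have "card H \<le> card G"
    proof (rule card_inj_on_le[of "\<lambda>(j, k). (j, c k)"])
      show "inj_on (\<lambda>(j, k). (j, c k)) H"
        using Q inj_onD[OF inj] by (fastforce simp: H_def inj_on_def)
      show "(\<lambda>(j, k). (j, c k)) ` H \<subseteq> G"
        using Q by (fastforce simp: H_def G_def W_def)
      show "finite G" by (rule finite_subset[of _ "{..<N} \<times> c ` {..<N}"]) (auto simp: G_def)
    qed
    then have "real (card H) ^ 3 \<le> real (card G) ^ 3" by (intro power_mono) auto
    also have "real (card G) ^ 3 \<le> 4096 * real N ^ 3 * real (card W) ^ 2"
      using incidences_cube_le[OF tame(2) _ finW, of "c ` {..<N}", folded G_def, unfolded cc, simplified]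
    proof
      assume "card G \<le> 16 * N"
      then have "real (card G) ^ 3 \<le> (16 * real N) ^ 3" by (intro power_mono) linarith+
      also have "\<dots> = 4096 * real N ^ 3 * 1" by (simp add: power_mult_distrib)
      also have "\<dots> \<le> 4096 * real N ^ 3 * real (card W) ^ 2"
        using W1 by (intro mult_left_mono one_le_power) auto
      finally show ?thesis .
    next
      assume "real (card G) ^ 3 \<le> 1040 * real N * (real N)\<^sup>2 * (real (card W))\<^sup>2"
      also have "\<dots> = 1040 * (real N ^ 3 * real (card W) ^ 2)" by (simp add: power2_eq_square power3_eq_cube)
      also have "\<dots> \<le> 4096 * (real N ^ 3 * real (card W) ^ 2)" by (intro mult_right_mono) auto
      finally show ?thesis by simp
    qed
    finally have "t ^ 6 * real (card H) ^ 3 \<le> t ^ 6 * (4096 * real N ^ 3 * real (card W) ^ 2)"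
      using t by (intro mult_left_mono) auto
    also have "\<dots> = 4096 * real N ^ 3 * (t ^ 6 * real (card W) ^ 2)" by simp
    also have "\<dots> \<le> 4096 * real N ^ 3 * (1040 ^ 2 * real N ^ 2 * real (card X) ^ 4)"
      using A by (intro mult_left_mono) auto
    also have "\<dots> = 4096 * 1040 ^ 2 * (real N ^ 5 * real (card X) ^ 4)" by (simp add: power_numeral_reduce)
    also have "\<dots> \<le> 1648 ^ 3 * (real N ^ 5 * real (card X) ^ 4)" by (intro mult_right_mono) auto
    finally have "(t ^ 2 * real (card H)) ^ 3 \<le> 1648 ^ 3 * real N ^ 5 * real (card X) ^ 4"
      by (simp add: power_mult_distrib mult.assoc flip: power_mult)
    then show ?thesis unfolding H_def w_def .
  qed
qed

text \<open>In logarithms, combining bounds with fractional exponents becomes linear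
  arithmetic.\<close>

lemma le_powr_quotient_iff_ln:
  fixes x y z C :: real
  assumes "x > 0" "y > 0" "z > 0" "C > 0"
  shows "x \<le> C * y powr p / z powr q \<longleftrightarrow> ln x \<le> ln C + p * ln y - q * ln z"
proof -
  have "x \<le> C * y powr p / z powr q \<longleftrightarrow> ln x \<le> ln (C * y powr p / z powr q)"
    using assms by (subst ln_le_cancel_iff) auto
  also have "ln (C * y powr p / z powr q) = ln C + p * ln y - q * ln z"
    using assms by (simp add: ln_mult ln_div ln_powr)
  finally show ?thesis .
qed

text \<open>Solutions form an antichain, so each diagonal of boxes of side \<open>L\<close> meets them in at most one box.\<close>

lemma card_isolated_le:
  assumes mono: "strict_mono_on {0..<N} a" "strict_mono_on {0..<N} b" "strict_mono_on {0..<N} c"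
  shows "card {(i, j, k). i < N \<and> j < N \<and> k < N \<and> a i + b j + c k = x \<and>
      (\<forall>i' j' k'. i' < N \<and> j' < N \<and> k' < N \<and> a i' + b j' + c k' = (x :: real) \<and>
        i div L = i' div L \<and> j div L = j' div L \<and> k div L = k' div L \<longrightarrow> (i', j', k') = (i, j, k))}
    \<le> (2 * (N div L) + 1) ^ 2"
    (is "card ?Iso \<le> _")
proof -
  \<comment> \<open>The differences of block indices name the diagonal of boxes. Two different boxes
    on one diagonal are strictly ordered in all three coordinates, so solutions in them would have
    different sums.\<close>
  define key where "key = (\<lambda>(i, j, k). (int (i div L) - int (j div L), int (j div L) - int (k div L)))"
  let ?M = "int (N div L)"
  have nolt: False if "i < N" "j < N" "k < N" "i' < N" "j' < N" "k' < N"
    "a i + b j + c k = x" "a i' + b j' + c k' = x" "i < i'" "j < j'" "k < k'" for i j k i' j' k'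
    using strict_mono_onD[OF mono(1), of i i'] strict_mono_onD[OF mono(2), of j j']
      strict_mono_onD[OF mono(3), of k k'] that by auto
  have divless: "p < q" if "p div L < q div L" for p q :: nat
    using that by (meson div_le_mono not_le)
  have "inj_on key ?Iso"
  proof (rule inj_onI)
    fix e e' assume mem: "e \<in> ?Iso" "e' \<in> ?Iso" and key: "key e = key e'"
    obtain i j k where e: "e = (i, j, k)" by (cases e)
    obtain i' j' k' where e': "e' = (i', j', k')" by (cases e')
    have lt: "i < N" "j < N" "k < N" "i' < N" "j' < N" "k' < N"
      and sum: "a i + b j + c k = x" "a i' + b j' + c k' = x"
      using mem unfolding e e' mem_Collect_eq prod.case by blast+
    have iso: "(p, q, r) = (i, j, k)" if "p < N" "q < N" "r < N" "a p + b q + c r = x"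
        "i div L = p div L" "j div L = q div L" "k div L = r div L" for p q r
      using mem(1) that unfolding e mem_Collect_eq prod.case by blast
    have d: "int (i' div L) - int (i div L) = int (j' div L) - int (j div L)"
      "int (k' div L) - int (k div L) = int (j' div L) - int (j div L)"
      using key by (simp_all add: key_def e e')
    have "j' div L = j div L"
    proof (rule linorder_cases)
      assume "j' div L < j div L"
      moreover from this d have "i' div L < i div L" "k' div L < k div L" by linarith+
      ultimately show ?thesis using nolt[OF lt(4-6,1-3) sum(2,1)] divless by blast
    next
      assume "j' div L = j div L"
      then show ?thesis .
    next
      assume "j' div L > j div L"
      moreover from this d have "i' div L > i div L" "k' div L > k div L" by linarith+
      ultimately show ?thesis using nolt[OF lt sum] divless by blast
    qed
    then have "(i', j', k') = (i, j, k)" using d by (intro iso lt sum) auto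
    then show "e = e'" by (simp add: e e')
  qed
  moreover have "key ` ?Iso \<subseteq> {- ?M..?M} \<times> {- ?M..?M}"
  proof -
    have "key (i, j, k) \<in> {- ?M..?M} \<times> {- ?M..?M}" if "i < N" "j < N" "k < N" for i j k
      using div_le_mono[of i N L] div_le_mono[of j N L] div_le_mono[of k N L] that
      unfolding key_def prod.case mem_Times_iff fst_conv snd_conv atLeastAtMost_iff by linarith
    then show ?thesis by blast
  qed
  ultimately have "card ?Iso \<le> card ({- ?M..?M} \<times> {- ?M..?M})"
    by (rule card_inj_on_le) auto
  also have "\<dots> = nat (2 * ?M + 1) ^ 2"
    by (simp add: card_cartesian_product power2_eq_square algebra_simps)
  also have "nat (2 * ?M + 1) = 2 * (N div L) + 1" by linarith
  finally show ?thesis .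
qed

text \<open>Two bounds on \<open>card X\<close> result: \<open>T \<le> N\<close> gives \<open>N^4 / r^2\<close>, good for small \<open>r\<close>, and the dyadic sum
  gives \<open>N^7 / r^(9/2)\<close>, good for large \<open>r\<close>; they overlap between \<open>N^(7/6)\<close> and \<open>N^(4/3)\<close>.\<close>

lemma degenerate_level_set_le:
  assumes tame: "piecewise_tame a N" "piecewise_tame b N" and inj: "inj_on c {..<N}"
    and X: "finite X" "X \<noteq> {}" and Q: "Q \<subseteq> {..<N} \<times> {..<N}"
    and cQ: "real (card Q) \<le> 648 * real N ^ 3 / r" and N: "N \<ge> 1" and r: "r \<ge> 1" "r \<le> real N ^ 2"
    and many: "real (card X) * r / 8 \<le> real (card {(i, j, k). i < N \<and> (j, k) \<in> Q \<and> a i + b j + c k \<in> X})"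
  shows "real (card X) \<le> 34000 ^ 3 * real N powr (14/3) / r powr (5/2)"
proof -
  define x where "x = real (card X)"
  define n where "n = real N"
  define w where "w = (\<lambda>(j, k). real (card {i. i < N \<and> a i + (b j + c k) \<in> X}))"
  \<comment> \<open>Chosen so that pairs with \<open>w q < T\<close> contribute at most half of the
    required \<open>x * r / 8\<close>; here \<open>10368 = 16 * 648\<close>.\<close>
  define T where "T = x * r ^ 2 / (10368 * n ^ 3)"
  have finQ: "finite Q" using Q by (rule finite_subset) auto
  have x: "x \<ge> 1" using X by (simp add: x_def Suc_leI card_gt_0_iff)
  have n: "n \<ge> 1" using N by (simp add: n_def)
  have T: "T > 0" using x r n by (simp add: T_def)
  have "card {(i, j, k). i < N \<and> (j, k) \<in> Q \<and> a i + b j + c k \<in> X}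
      = card ((\<lambda>((j, k), i). (i, j, k)) ` (SIGMA q:Q. {i. i < N \<and> a i + (b (fst q) + c (snd q)) \<in> X}))"
    by (rule arg_cong[where f = card]) (force simp: add.assoc)
  also have "\<dots> = card (SIGMA q:Q. {i. i < N \<and> a i + (b (fst q) + c (snd q)) \<in> X})"
    by (rule card_image) (auto simp: inj_on_def)
  also have "real \<dots> = (\<Sum>q\<in>Q. w q)"
    using finQ by (simp add: card_SigmaI w_def case_prod_beta)
  finally have "x * r / 8 \<le> (\<Sum>q\<in>Q. w q)" using many by (simp add: x_def)
  also have "\<dots> = (\<Sum>q\<in>{q \<in> Q. w q < T}. w q) + (\<Sum>q\<in>{q \<in> Q. T \<le> w q}. w q)"
    using finQ by (subst sum.union_disjoint[symmetric]) (auto intro!: sum.cong)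
  also have "(\<Sum>q\<in>{q \<in> Q. w q < T}. w q) \<le> real (card {q \<in> Q. w q < T}) * T"
    by (intro sum_bounded_above) auto
  also have "\<dots> \<le> real (card Q) * T"
    using finQ T by (intro mult_right_mono) (auto intro: card_mono)
  also have "\<dots> \<le> (648 * n ^ 3 / r) * T" using cQ T by (intro mult_right_mono) (auto simp: n_def)
  also have "\<dots> = x * r / 16" using r n by (simp add: T_def power2_eq_square field_simps)
  finally have G: "x * r / 16 \<le> (\<Sum>q\<in>{q \<in> Q. T \<le> w q}. w q)" by linarith
  have xr: "x * r / 16 > 0" using x r by simp
  \<comment> \<open>Some pair is rich, and no pair has more than \<open>N\<close> values of
    \<open>i\<close>. Hence \<open>T \<le> n\<close>, which is the bound of order
    \<open>n ^ 4 / r ^ 2\<close> on \<open>x\<close>.\<close>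
  have "{q \<in> Q. T \<le> w q} \<noteq> {}"
  proof
    assume "{q \<in> Q. T \<le> w q} = {}"
    then have "(\<Sum>q\<in>{q \<in> Q. T \<le> w q}. w q) = 0" by (simp only: sum.empty)
    then show False using G xr by simp
  qed
  then obtain q where "T \<le> w q" by blast
  also have "w q \<le> n"
  proof -
    have "w q \<le> real (card {..<N})"
      unfolding w_def by (cases q) (auto simp del: card_lessThan intro!: card_mono)
    then show ?thesis by (simp add: n_def)
  qed
  finally have TN: "T \<le> n" .
  have lnT: "ln T = ln x + 2 * ln r - ln 10368 - 3 * ln n"
    using x r n by (simp add: T_def ln_mult ln_div ln_realpow)
  have pos: "x > 0" "n > 0" "r > 0" using x n r by auto
  have lnn: "ln n \<ge> 0" using n by simp
  have lnr: "ln r \<le> 2 * ln n"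
  proof -
    have "ln r \<le> ln (n ^ 2)" using r n pos by (subst ln_le_cancel_iff) (auto simp: n_def)
    then show ?thesis using pos by (simp add: ln_realpow)
  qed
  have ln34: "ln (34000 ^ 3 :: real) = 3 * ln 34000" by (simp only: ln_realpow of_nat_numeral)
  have const: "ln (10368 :: real) \<le> 3 * ln 34000" "ln 16 + ln (10368 :: real) \<le> 3 * ln 34000"
    "ln 105472 + ln (10368 :: real) \<le> 2 * ln 34000"
  proof -
    show "ln (10368 :: real) \<le> 3 * ln 34000"
      unfolding ln34[symmetric] by (subst ln_le_cancel_iff) simp_all
    have "ln 16 + ln (10368 :: real) = ln (16 * 10368)" by (rule ln_mult_pos[symmetric]) simp_all
    also have "\<dots> \<le> ln (34000 ^ 3)" by (subst ln_le_cancel_iff) simp_all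
    finally show "ln 16 + ln (10368 :: real) \<le> 3 * ln 34000" unfolding ln34 .
    have "ln 105472 + ln (10368 :: real) = ln (105472 * 10368)"
      by (simp only: ln_mult_pos mult_pos_pos zero_less_numeral)
    also have "\<dots> \<le> ln (34000 ^ 2)" by (subst ln_le_cancel_iff) simp_all
    also have "\<dots> = 2 * ln (34000 :: real)" by (simp only: ln_realpow of_nat_numeral)
    finally show "ln 105472 + ln (10368 :: real) \<le> 2 * ln 34000" .
  qed
  have "ln x \<le> ln (34000 ^ 3) + 14/3 * ln n - 5/2 * ln r"
  proof (cases "T \<le> 16")
    \<comment> \<open>Here \<open>x\<close> is of order at most \<open>n ^ 3 / r ^ 2\<close>, which
      suffices because \<open>r \<le> n ^ 2\<close>.\<close>
    case True
    then have "ln T \<le> ln 16" using T by simp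
    then show ?thesis using lnT lnr lnn const ln34 by linarith
  next
    case False
    define K where "K = 1648 * n powr (5/3) * x powr (4/3)"
    have K: "K > 0" using pos by (simp add: K_def)
    have "(\<Sum>q\<in>{q \<in> Q. T \<le> w q}. w q powr 1) \<le> 4 * K * T powr (1 - 2)"
    proof (rule dyadic_sum_le[OF finQ T])
      fix t assume t: "T \<le> t"
      define H where "H = real (card {q \<in> Q. t \<le> w q})"
      have "{q \<in> Q. t \<le> w q} = {(j, k) \<in> Q. t \<le> real (card {i. i < N \<and> a i + (b j + c k) \<in> X})}"
        by (auto simp: w_def)
      then have "(t ^ 2 * H) ^ 3 \<le> 1648 ^ 3 * n ^ 5 * x ^ 4"
        using card_rich_pairs_cube_le[OF tame inj X(1) Q, of t] False t
        unfolding H_def n_def x_def by simp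
      also have "\<dots> = K ^ 3"
      proof -
        have "(x powr (4/3)) ^ 3 = x ^ 4"
        proof -
          have "(x powr (4/3)) ^ 3 = (x powr (4/3)) powr real 3"
            using pos by (intro powr_realpow[symmetric]) simp
          also have "\<dots> = x powr real 4" unfolding powr_powr by simp
          also have "\<dots> = x ^ 4" using pos by (intro powr_realpow)
          finally show ?thesis .
        qed
        then show ?thesis by (simp add: K_def power_mult_distrib powr_five_thirds_cubed pos)
      qed
      finally have "t ^ 2 * H \<le> K" using K by (subst (asm) power_mono_iff) (auto simp: H_def)
      moreover have "t powr (- 2) = inverse (t ^ 2)" using t T by (simp add: powr_minus)
      moreover have "t ^ 2 > 0" using t T by simp
      ultimately have "H \<le> K * t powr (- 2)" by (simp only: divide_inverse[symmetric] pos_le_divide_eq mult.commute)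
      moreover have "real (card {q \<in> Q. t \<le> w q \<and> w q < 2 * t}) \<le> H"
        unfolding H_def using finQ by (auto intro!: card_mono)
      ultimately show "real (card {q \<in> Q. t \<le> w q \<and> w q < 2 * t}) \<le> K * t powr (- 2)" by linarith
    qed (use K in \<open>auto simp: powr_minus\<close>)
    moreover have "(\<Sum>q\<in>{q \<in> Q. T \<le> w q}. w q powr 1) = (\<Sum>q\<in>{q \<in> Q. T \<le> w q}. w q)"
      using T by (intro sum.cong) auto
    moreover have "T powr (1 - 2) = 1 / T" using T by (simp add: powr_minus inverse_eq_divide)
    ultimately have "x * r / 16 \<le> 4 * K / T" using G by simp
    then have "x * r * T \<le> 64 * K" using T by (simp add: field_simps)
    then have "ln (x * r * T) \<le> ln (64 * K)" using pos T K by (subst ln_le_cancel_iff) auto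
    then have "ln x + ln r + ln T \<le> ln 105472 + (5/3 * ln n + 4/3 * ln x)"
      using pos T by (simp add: K_def ln_mult ln_powr)
    moreover have "ln T \<le> ln n" using TN T pos by simp
    \<comment> \<open>Weights \<open>4/5\<close> and \<open>1/5\<close> on the bounds
      \<open>n ^ 4 / r ^ 2\<close> and \<open>n ^ 7 / r powr (9/2)\<close> yield
      \<open>n powr (23/5) / r powr (5/2)\<close>, and \<open>23/5 < 14/3\<close>.\<close>
    ultimately show ?thesis using lnT lnn const ln34 by argo
  qed
  then show ?thesis
    using le_powr_quotient_iff_ln[of x n r "34000 ^ 3" "14/3" "5/2"] pos by (simp add: x_def n_def)
qed

section \<open>Level sets and energy\<close>

text \<open>There are at least \<open>card X * r\<close> solutions with sum in \<open>X\<close>.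
  They are split according to how a solution shares its box with another one of the same sum: not at
  all, with all coordinates different, or with a common coordinate.\<close>

lemma level_set_le:
  assumes conv: "convex2_on a N" "convex2_on b N" "convex2_on c N"
    and X: "finite X" and r: "r \<ge> 1"
    and rich: "\<And>x. x \<in> X \<Longrightarrow> r \<le> real (card {(i, j, k). i < N \<and> j < N \<and> k < N \<and> a i + b j + c k = x})"
  shows "real (card X) \<le> 34000 ^ 3 * real N powr (14/3) / r powr (5/2)"
proof (cases "X = {}")
  case False
  define x where "x = real (card X)"
  define n where "n = real N"
  define sols where "sols y = {(i, j, k). i < N \<and> j < N \<and> k < N \<and> a i + b j + c k = y}" for y
  have fin: "finite A" if "A \<subseteq> {..<N} \<times> {..<N} \<times> {..<N}" for A
    using that by (rule finite_subset) auto
  have rich': "r \<le> real (card (sols y))" if "y \<in> X" for y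
    using rich[OF that] unfolding sols_def .
  have finsols: "finite (sols y)" for y by (rule fin) (auto simp: sols_def)
  have mono: "strict_mono_on {0..<N} a" "strict_mono_on {0..<N} b" "strict_mono_on {0..<N} c"
    using conv by (auto simp: convex2_on_def)
  have inj: "inj_on c {..<N}" "inj_on b {..<N}"
    using mono strict_mono_on_imp_inj_on unfolding atLeast0LessThan by blast+
  have x: "x \<ge> 1" using X False by (simp add: x_def Suc_leI card_gt_0_iff)
  obtain y0 where y0: "y0 \<in> X" using False by blast
  have "sols y0 \<noteq> {}" using rich'[OF y0] r by auto
  then have N: "N \<ge> 1" by (auto simp: sols_def)
  then have n: "n \<ge> 1" by (simp add: n_def)
  have pos: "x > 0" "n > 0" "r > 0" using x n r by auto
  have lnn: "ln n \<ge> 0" using n by simp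
  have ln34: "ln (34000 ^ 3 :: real) = 3 * ln 34000" by (simp only: ln_realpow of_nat_numeral)
  have goalI: ?thesis if "ln x \<le> 3 * ln 34000 + 14/3 * ln n - 5/2 * ln r"
    using le_powr_quotient_iff_ln[of x n r "34000 ^ 3" "14/3" "5/2"] pos that ln34 by (simp add: x_def n_def)
  show ?thesis
  proof (cases "r < 16")
    \<comment> \<open>For bounded \<open>r\<close> the trivial bound \<open>n ^ 3\<close> on the
      number of sums is enough.\<close>
    case True
    have "X \<subseteq> (\<lambda>(i, j, k). a i + b j + c k) ` ({..<N} \<times> {..<N} \<times> {..<N})"
    proof
      fix y assume "y \<in> X"
      then have "sols y \<noteq> {}" using rich'[of y] r by auto
      then show "y \<in> (\<lambda>(i, j, k). a i + b j + c k) ` ({..<N} \<times> {..<N} \<times> {..<N})"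
        by (force simp: sols_def)
    qed
    then have "card X \<le> card ({..<N} \<times> {..<N} \<times> {..<N})"
      by (intro surj_card_le) auto
    then have "card X \<le> N ^ 3" by (simp add: card_cartesian_product power3_eq_cube)
    then have "x \<le> n ^ 3" unfolding x_def n_def by (metis of_nat_le_iff of_nat_power)
    then have "ln x \<le> ln (n ^ 3)" using pos by (subst ln_le_cancel_iff) auto
    then have "ln x \<le> 3 * ln n" by (simp add: ln_realpow)
    moreover have "ln r \<le> ln 34000" using pos True by (subst ln_le_cancel_iff) auto
    moreover have "ln (34000 :: real) \<ge> 0" by simp
    ultimately show ?thesis using lnn by (intro goalI) linarith
  next
    case False
    have "card (sols y0) \<le> card ({..<N} \<times> {..<N})"
    proof (rule card_inj_on_le[of "\<lambda>(i, j, k). (i, j)"])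
      show "inj_on (\<lambda>(i, j, k). (i, j)) (sols y0)"
        using inj_onD[OF inj(1)] by (fastforce simp: inj_on_def sols_def)
    qed (auto simp: sols_def)
    then have "real (card (sols y0)) \<le> n ^ 2"
      by (simp add: card_cartesian_product n_def power2_eq_square flip: of_nat_mult)
    then have rN: "r \<le> n ^ 2" using rich'[OF y0] by linarith
    define s where "s = sqrt r"
    have s: "s \<ge> 4" "s ^ 2 = r" using False r by (auto simp: s_def real_le_rsqrt)
    have sn: "s \<le> n" using rN n by (simp add: s_def real_le_lsqrt)
    \<comment> \<open>This side leaves at most \<open>s / 8\<close> as the value of
      \<open>N div L\<close>. Since \<open>s \<ge> 4\<close>, \<open>2 * M + 1\<close> is then at
      most \<open>s / 2\<close>, so each sum has at most \<open>r / 4\<close> isolated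
      solutions.\<close>
    define L where "L = nat \<lceil>8 * n / s\<rceil>"
    define z where "z = n / s"
    have z: "1 \<le> z" "8 * n / s = 8 * z" using sn s by (simp_all add: z_def)
    have L: "8 * z \<le> real L" "real L \<le> 9 * z"
      unfolding L_def z(2) using z(1) by linarith+
    have L0: "L > 0" using L z by (cases "L = 0") auto
    define M where "M = N div L"
    have "real M \<le> n / real L" unfolding M_def n_def by (rule of_nat_div_le_of_nat)
    also have "\<dots> \<le> n / (8 * z)" using L z n by (intro divide_left_mono) auto
    also have "\<dots> = s / 8" using n s by (simp add: z_def)
    finally have M: "real M \<le> s / 8" .
    have M2: "(2 * real M + 1) ^ 2 \<le> r / 4"
    proof -
      have "(2 * real M + 1) ^ 2 \<le> (s / 2) ^ 2" using M s by (intro power_mono) linarith+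
      then show ?thesis using s by (simp add: power_divide)
    qed
    define iso where "iso y = {(i, j, k). i < N \<and> j < N \<and> k < N \<and> a i + b j + c k = y \<and>
      (\<forall>i' j' k'. i' < N \<and> j' < N \<and> k' < N \<and> a i' + b j' + c k' = y \<and>
        i div L = i' div L \<and> j div L = j' div L \<and> k div L = k' div L \<longrightarrow> (i', j', k') = (i, j, k))}" for y
    define P where "P = (\<Union>y\<in>X. sols y)"
    define Z0 where "Z0 = {(i, j, k). i < N \<and> j < N \<and> k < N \<and>
      (\<exists>i' j' k'. i' < N \<and> j' < N \<and> k' < N \<and> i \<noteq> i' \<and> j \<noteq> j' \<and> k \<noteq> k' \<and>
        i div L = i' div L \<and> j div L = j' div L \<and> k div L = k' div L \<and>
        a i + b j + c k = a i' + b j' + c k')}"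
    \<comment> \<open>In \<open>Z1\<close>, \<open>Z2\<close> and \<open>Z3\<close> the shared
      coordinate is listed first, so that one lemma treats all three after permuting the
      sequences.\<close>
    define Z1 where "Z1 = {(i, j, k). i < N \<and> (j, k) \<in> close_pairs b c N L \<and> a i + b j + c k \<in> X}"
    define Z2 where "Z2 = {(j, i, k). j < N \<and> (i, k) \<in> close_pairs a c N L \<and> b j + a i + c k \<in> X}"
    define Z3 where "Z3 = {(k, i, j). k < N \<and> (i, j) \<in> close_pairs a b N L \<and> c k + a i + b j \<in> X}"
    define I where "I = (\<Union>y\<in>X. iso y)"
    have cover: "P \<subseteq> I \<union> Z0 \<union> Z1 \<union> (\<lambda>(j, i, k). (i, j, k)) ` Z2 \<union> (\<lambda>(k, i, j). (i, j, k)) ` Z3"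
    proof
      fix e assume "e \<in> P"
      then obtain i j k where e: "e = (i, j, k)" and lt: "i < N" "j < N" "k < N"
        and inX: "a i + b j + c k \<in> X" by (auto simp: P_def sols_def)
      show "e \<in> I \<union> Z0 \<union> Z1 \<union> (\<lambda>(j, i, k). (i, j, k)) ` Z2 \<union> (\<lambda>(k, i, j). (i, j, k)) ` Z3"
      proof (cases "e \<in> iso (a i + b j + c k)")
        case True
        then show ?thesis using inX by (auto simp: I_def)
      next
        case False
        then obtain i' j' k' where lt': "i' < N" "j' < N" "k' < N"
          and eq: "a i' + b j' + c k' = a i + b j + c k"
          and bl: "i div L = i' div L" "j div L = j' div L" "k div L = k' div L"
          and ne: "(i', j', k') \<noteq> (i, j, k)"
          using lt unfolding e iso_def mem_Collect_eq prod.case by blast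
        consider "i = i'" | "j = j'" | "k = k'" | "i \<noteq> i'" "j \<noteq> j'" "k \<noteq> k'" by blast
        then show ?thesis
        proof cases
          case 1
          then have "\<exists>j' k'. j' < N \<and> k' < N \<and> (j, k) \<noteq> (j', k') \<and> j div L = j' div L \<and> k div L = k' div L \<and> b j + c k = b j' + c k'"
            using lt' eq bl ne by (intro exI[of _ j'] exI[of _ k']) auto
          then have "(j, k) \<in> close_pairs b c N L" using lt unfolding close_pairs_def by blast
          then show ?thesis using lt inX by (simp add: e Z1_def)
        next
          case 2
          then have "\<exists>i' k'. i' < N \<and> k' < N \<and> (i, k) \<noteq> (i', k') \<and> i div L = i' div L \<and> k div L = k' div L \<and> a i + c k = a i' + c k'"
            using lt' eq bl ne by (intro exI[of _ i'] exI[of _ k']) auto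
          then have "(i, k) \<in> close_pairs a c N L" using lt unfolding close_pairs_def by blast
          then have "(j, i, k) \<in> Z2" using lt inX by (simp add: Z2_def add_ac)
          then show ?thesis by (force simp: e)
        next
          case 3
          then have "\<exists>i' j'. i' < N \<and> j' < N \<and> (i, j) \<noteq> (i', j') \<and> i div L = i' div L \<and> j div L = j' div L \<and> a i + b j = a i' + b j'"
            using lt' eq bl ne by (intro exI[of _ i'] exI[of _ j']) auto
          then have "(i, j) \<in> close_pairs a b N L" using lt unfolding close_pairs_def by blast
          then have "(k, i, j) \<in> Z3" using lt inX by (simp add: Z3_def add_ac)
          then show ?thesis by (force simp: e)
        next
          case 4
          then have "(i, j, k) \<in> Z0"
            unfolding Z0_def mem_Collect_eq prod.case using lt lt' bl eq[symmetric] by blast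
          then show ?thesis by (simp add: e)
        qed
      qed
    qed
    have cp: "close_pairs f g N L \<subseteq> {..<N} \<times> {..<N}" for f g by (auto simp: close_pairs_def)
    have finZ: "finite Z0" "finite Z1" "finite Z2" "finite Z3" and finI: "finite I"
      using cp X by (auto intro!: fin simp: Z0_def Z1_def Z2_def Z3_def I_def iso_def)
    have "card P \<le> card (I \<union> Z0 \<union> Z1 \<union> (\<lambda>(j, i, k). (i, j, k)) ` Z2 \<union> (\<lambda>(k, i, j). (i, j, k)) ` Z3)"
      using cover finZ finI by (intro card_mono) auto
    also have "\<dots> \<le> card I + card Z0 + card Z1 + card ((\<lambda>(j, i, k). (i, j, k)) ` Z2) + card ((\<lambda>(k, i, j). (i, j, k)) ` Z3)"
      by (intro order_trans[OF card_Un_le] add_mono order_refl)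
    also have "\<dots> \<le> card I + card Z0 + card Z1 + card Z2 + card Z3"
      using finZ by (intro add_mono card_image_le) auto
    finally have cP: "card P \<le> card I + card Z0 + card Z1 + card Z2 + card Z3" .
    have "card P = (\<Sum>y\<in>X. card (sols y))"
      unfolding P_def using X finsols by (intro card_UN_disjoint) (auto simp: sols_def)
    then have "real (card P) = (\<Sum>y\<in>X. real (card (sols y)))" by simp
    also have "\<dots> \<ge> (\<Sum>y\<in>X. r)" using rich' by (intro sum_mono)
    finally have Plow: "x * r \<le> real (card P)" by (simp add: x_def)
    have "card I \<le> card X * (2 * M + 1) ^ 2"
      unfolding I_def
    proof (rule card_UN_le_mult[OF X])
      fix y show "card (iso y) \<le> (2 * M + 1) ^ 2"
        unfolding iso_def M_def by (rule card_isolated_le[OF mono])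
    qed
    then have "real (card I) \<le> real (card X * (2 * M + 1) ^ 2)" by (simp only: of_nat_le_iff)
    also have "\<dots> = x * (2 * real M + 1) ^ 2" by (simp add: x_def add.commute)
    also have "\<dots> \<le> x * (r / 4)" using M2 x by (intro mult_left_mono) auto
    finally have cI: "real (card I) \<le> x * r / 4" by simp
    have zr: "z ^ 2 = n ^ 2 / r" using s by (simp add: z_def power_divide)
    have cQ: "real (card (close_pairs f g N L)) \<le> 648 * real N ^ 3 / r"
      if "convex2_on f N" "convex2_on g N" for f g
    proof -
      have "card (close_pairs f g N L) \<le> 8 * L ^ 2 * N" by (rule card_close_pairs_le[OF that L0])
      then have "real (card (close_pairs f g N L)) \<le> 8 * real L ^ 2 * n"
        unfolding n_def by (simp only: of_nat_le_iff[where 'a = real, symmetric]) simp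
      also have "\<dots> \<le> 8 * (9 * z) ^ 2 * n"
        using L n by (intro mult_right_mono mult_left_mono power_mono) auto
      also have "\<dots> = 648 * (z ^ 2) * n" by (simp add: power_mult_distrib)
      also have "\<dots> = 648 * real N ^ 3 / r" unfolding zr n_def by (simp add: power2_eq_square power3_eq_cube)
      finally show ?thesis .
    qed
    note deg = degenerate_level_set_le[OF _ _ _ X \<open>X \<noteq> {}\<close> cp cQ N r rN[unfolded n_def]]
    \<comment> \<open>Isolated solutions use at most a quarter of \<open>x * r\<close>; of the
      remaining three quarters, one of four sets receives at least \<open>3/16\<close>.\<close>
    have "x * r / 8 \<le> real (card Z0) \<or> x * r / 8 \<le> real (card Z1) \<or>
        x * r / 8 \<le> real (card Z2) \<or> x * r / 8 \<le> real (card Z3)"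
    proof -
      have "x * r \<le> x * r / 4 + real (card Z0) + real (card Z1) + real (card Z2) + real (card Z3)"
        using Plow cP cI by linarith
      moreover have "x * r > 0" using pos by simp
      ultimately show ?thesis by linarith
    qed
    then show ?thesis
    proof (elim disjE)
      \<comment> \<open>This case yields the exponents of the theorem directly, since
        \<open>z ^ 3\<close> equals \<open>n ^ 3 / r powr (3/2)\<close>. The constant is
        \<open>8 * 512 * 9 ^ 3\<close>.\<close>
      assume "x * r / 8 \<le> real (card Z0)"
      also have "\<dots> \<le> 512 * real L ^ 3 * real N powr (5/3)"
        unfolding Z0_def by (rule card_generic_pairs_le[OF conv L0])
      also have "\<dots> \<le> 512 * (9 * z) ^ 3 * n powr (5/3)"
        unfolding n_def using L by (intro mult_right_mono mult_left_mono power_mono) auto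
      finally have "x * r \<le> 2985984 * z ^ 3 * n powr (5/3)" by (simp add: power_mult_distrib)
      moreover have "z > 0" using z by simp
      ultimately have "ln (x * r) \<le> ln (2985984 * z ^ 3 * n powr (5/3))"
        using pos by (subst ln_le_cancel_iff) auto
      then have "ln x + ln r \<le> ln 2985984 + 3 * ln z + 5/3 * ln n"
        using pos \<open>z > 0\<close> by (simp add: ln_mult ln_realpow ln_powr)
      moreover have "ln z = ln n - 1/2 * ln r"
        using pos by (simp add: z_def s_def ln_div ln_sqrt)
      moreover have "ln (2985984 :: real) \<le> ln (34000 ^ 3)" by (subst ln_le_cancel_iff) auto
      ultimately show ?thesis unfolding ln34 by (intro goalI) argo
    next
      assume "x * r / 8 \<le> real (card Z1)"
      then show ?thesis
        unfolding Z1_def x_def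
        by (rule deg[OF piecewise_tame_convex2[OF conv(1)] piecewise_tame_convex2[OF conv(2)] inj(1) conv(2,3)])
    next
      assume "x * r / 8 \<le> real (card Z2)"
      then show ?thesis
        unfolding Z2_def x_def
        by (rule deg[OF piecewise_tame_convex2[OF conv(2)] piecewise_tame_convex2[OF conv(1)] inj(1) conv(1,3)])
    next
      assume "x * r / 8 \<le> real (card Z3)"
      then show ?thesis
        unfolding Z3_def x_def
        by (rule deg[OF piecewise_tame_convex2[OF conv(3)] piecewise_tame_convex2[OF conv(1)] inj(2) conv(1,2)])
    qed
  qed
qed (use r in simp)

section \<open>Representation counts and energy\<close>

lemma rep3_enumeration:
  assumes "bij_betw a {..<N} A1" "bij_betw b {..<N} A2" "bij_betw c {..<N} A3"
  shows "rep3 A1 A2 A3 x = card {(i, j, k). i < N \<and> j < N \<and> k < N \<and> a i + b j + c k = x}"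
proof -
  let ?S = "{(i, j, k). i < N \<and> j < N \<and> k < N \<and> a i + b j + c k = x}"
  have A: "A1 = a ` {..<N}" "A2 = b ` {..<N}" "A3 = c ` {..<N}"
    using assms by (auto simp: bij_betw_def)
  have "{(a1, a2, a3). a1 \<in> A1 \<and> a2 \<in> A2 \<and> a3 \<in> A3 \<and> a1 + a2 + a3 = x} = (\<lambda>(i, j, k). (a i, b j, c k)) ` ?S"
    unfolding A by (auto simp: image_iff) blast
  moreover have "inj_on (\<lambda>(i, j, k). (a i, b j, c k)) ?S"
    using assms by (auto simp: bij_betw_def inj_on_def)
  ultimately show ?thesis unfolding rep3_def by (simp add: card_image)
qed

lemma sumset3_eq: "sumset3 A1 A2 A3 = (\<lambda>(x, y, z). x + y + z) ` (A1 \<times> A2 \<times> A3)"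
proof (intro equalityI subsetI)
  fix s assume "s \<in> sumset3 A1 A2 A3"
  then obtain x y z where "x \<in> A1" "y \<in> A2" "z \<in> A3" "s = x + y + z"
    unfolding sumset3_def by blast
  then show "s \<in> (\<lambda>(x, y, z). x + y + z) ` (A1 \<times> A2 \<times> A3)"
    by (intro image_eqI[of _ _ "(x, y, z)"]) auto
next
  fix s assume "s \<in> (\<lambda>(x, y, z). x + y + z) ` (A1 \<times> A2 \<times> A3)"
  then obtain x y z where "x \<in> A1" "y \<in> A2" "z \<in> A3" "s = x + y + z" by auto
  then show "s \<in> sumset3 A1 A2 A3" unfolding sumset3_def by blast
qed

lemma energy3_eq_sum:
  assumes "finite A1" "finite A2" "finite A3"
  shows "energy3 A1 A2 A3 = (\<Sum>x\<in>sumset3 A1 A2 A3. rep3 A1 A2 A3 x ^ 2)"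
proof -
  define R where "R x = {(a1, a2, a3). a1 \<in> A1 \<and> a2 \<in> A2 \<and> a3 \<in> A3 \<and> a1 + a2 + a3 = x}" for x
  have finR: "finite (R x)" for x
    by (rule finite_subset[of _ "A1 \<times> A2 \<times> A3"]) (use assms in \<open>auto simp: R_def\<close>)
  have "energy3 A1 A2 A3 = card (\<Union>x\<in>sumset3 A1 A2 A3. R x \<times> R x)"
    unfolding energy3_def by (rule arg_cong[where f = card]) (auto simp: R_def sumset3_def)
  also have "\<dots> = (\<Sum>x\<in>sumset3 A1 A2 A3. card (R x \<times> R x))"
    using assms finR by (intro card_UN_disjoint) (auto simp: R_def sumset3_eq)
  finally show ?thesis by (simp add: R_def rep3_def card_cartesian_product power2_eq_square)
qed

lemma sum_rep3:
  assumes "finite A1" "finite A2" "finite A3"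
  shows "(\<Sum>x\<in>sumset3 A1 A2 A3. rep3 A1 A2 A3 x) = card A1 * card A2 * card A3"
proof -
  define R where "R x = {(a1, a2, a3). a1 \<in> A1 \<and> a2 \<in> A2 \<and> a3 \<in> A3 \<and> a1 + a2 + a3 = x}" for x
  have finR: "finite (R x)" for x
    by (rule finite_subset[of _ "A1 \<times> A2 \<times> A3"]) (use assms in \<open>auto simp: R_def\<close>)
  have "card (A1 \<times> A2 \<times> A3) = card (\<Union>x\<in>sumset3 A1 A2 A3. R x)"
    by (rule arg_cong[where f = card]) (auto simp: R_def sumset3_def)
  also have "\<dots> = (\<Sum>x\<in>sumset3 A1 A2 A3. card (R x))"
    using assms finR by (intro card_UN_disjoint) (auto simp: R_def sumset3_eq)
  finally show ?thesis by (simp add: R_def rep3_def card_cartesian_product mult.assoc)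
qed

lemma energy3_le:
  fixes N :: nat and D :: real
  assumes fin: "finite A1" "finite A2" "finite A3" and card: "card A1 = N" "card A2 = N" "card A3 = N"
    and D: "D \<ge> 0"
    and level: "\<And>r. r \<ge> 1 \<Longrightarrow> real (card {x \<in> sumset3 A1 A2 A3. r \<le> real (rep3 A1 A2 A3 x) \<and> real (rep3 A1 A2 A3 x) < 2 * r})
      \<le> D * real N powr (14/3) / r powr (5/2)"
  shows "real (energy3 A1 A2 A3) \<le> (1 + 16 * D) * real N powr (37/9)"
proof (cases "N = 0")
  case True
  then show ?thesis using energy3_eq_sum[OF fin] card fin by (simp add: sumset3_eq)
next
  case False
  define n where "n = real N"
  define S where "S = sumset3 A1 A2 A3"
  define w where "w x = real (rep3 A1 A2 A3 x)" for x
  \<comment> \<open>The threshold balances the contribution \<open>T * n ^ 3\<close> of small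
    multiplicities against \<open>n powr (14/3) / sqrt T\<close> of large ones; both equal
    \<open>n powr (37/9)\<close>.\<close>
  define T where "T = n powr (10/9)"
  have n: "n \<ge> 1" using False by (simp add: n_def)
  have T: "T \<ge> 1" using n by (simp add: T_def ge_one_powr_ge_zero)
  have finS: "finite S" using fin by (simp add: S_def sumset3_eq)
  have w0: "w x \<ge> 0" for x by (simp add: w_def)
  have "(\<Sum>x\<in>{x \<in> S. T \<le> w x}. w x powr 2) \<le> 16 * (D * n powr (14/3)) * T powr (2 - 5/2)"
  proof (rule dyadic_sum_le[OF finS])
    fix t assume "T \<le> t"
    then have "t \<ge> 1" using T by simp
    then show "real (card {x \<in> S. t \<le> w x \<and> w x < 2 * t}) \<le> (D * n powr (14/3)) * t powr (- (5/2))"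
      unfolding S_def w_def n_def powr_minus divide_inverse[symmetric] by (rule level)
  next
    \<comment> \<open>The constant 16 closes the dyadic induction because
      \<open>4 + 16 * (3/4) = 16\<close>.\<close>
    have "2 powr (2 - 5/2 :: real) = 1 / sqrt 2" by (simp add: powr_minus_divide powr_half_sqrt)
    also have "\<dots> \<le> 3/4"
    proof -
      have "4/3 \<le> sqrt (2 :: real)" by (rule real_le_rsqrt) (simp add: power2_eq_square)
      then show ?thesis by (simp add: field_simps)
    qed
    finally show "2 powr 2 + 16 * 2 powr (2 - 5/2) \<le> (16 :: real)" by simp
  qed (use T D in auto)
  also have "\<dots> = 16 * D * n powr (37/9)"
  proof -
    have "T powr (2 - 5/2) = n powr (- 5/9)" by (simp add: T_def powr_powr)
    moreover have "n powr (14/3) * n powr (- 5/9) = n powr (37/9)" by (simp flip: powr_add)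
    ultimately show ?thesis by simp
  qed
  also have "(\<Sum>x\<in>{x \<in> S. T \<le> w x}. w x powr 2) = (\<Sum>x\<in>{x \<in> S. T \<le> w x}. w x ^ 2)"
    using w0 by (intro sum.cong) auto
  finally have high: "(\<Sum>x\<in>{x \<in> S. T \<le> w x}. w x ^ 2) \<le> 16 * D * n powr (37/9)" .
  have "(\<Sum>x\<in>{x \<in> S. w x < T}. w x ^ 2) \<le> (\<Sum>x\<in>{x \<in> S. w x < T}. T * w x)"
    using w0 by (intro sum_mono) (auto simp: power2_eq_square intro!: mult_right_mono)
  also have "\<dots> \<le> (\<Sum>x\<in>S. T * w x)"
    using finS w0 T by (intro sum_mono2) auto
  also have "\<dots> = T * n ^ 3"
    using sum_rep3[OF fin] unfolding sum_distrib_left[symmetric] w_def S_def of_nat_sum[symmetric]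
    by (simp add: card n_def power3_eq_cube)
  also have "\<dots> = n powr (37/9)"
  proof -
    have "n ^ 3 = n powr real 3" using n by (intro powr_realpow[symmetric]) simp
    then show ?thesis by (simp add: T_def flip: powr_add)
  qed
  finally have low: "(\<Sum>x\<in>{x \<in> S. w x < T}. w x ^ 2) \<le> n powr (37/9)" .
  have "real (energy3 A1 A2 A3) = (\<Sum>x\<in>S. w x ^ 2)"
    by (simp add: energy3_eq_sum[OF fin] S_def w_def)
  also have "\<dots> = (\<Sum>x\<in>{x \<in> S. w x < T}. w x ^ 2) + (\<Sum>x\<in>{x \<in> S. T \<le> w x}. w x ^ 2)"
    using finS by (subst sum.union_disjoint[symmetric]) (auto intro!: sum.cong)
  finally show ?thesis using low high by (simp add: n_def distrib_right)
qed

theorem theorem5p2: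
  "\<exists>C > 0. \<forall>(A1 :: real set) A2 A3 (N :: nat).
     convex_set 2 A1 \<and> convex_set 2 A2 \<and> convex_set 2 A3 \<and>
     card A1 = N \<and> card A2 = N \<and> card A3 = N \<longrightarrow>
     (\<forall>r :: real. r \<ge> 1 \<longrightarrow>
        real (card {x \<in> sumset3 A1 A2 A3. r \<le> real (rep3 A1 A2 A3 x) \<and> real (rep3 A1 A2 A3 x) < 2 * r})
          \<le> C * real N powr (14/3) / r powr (5/2)) \<and>
     real (energy3 A1 A2 A3) \<le> C * real N powr (37/9)"
proof (intro exI[of _ "1 + 16 * 34000 ^ 3 :: real"] conjI allI impI; (elim conjE)?)
  fix A1 A2 A3 :: "real set" and N :: nat
  assume conv: "convex_set 2 A1" "convex_set 2 A2" "convex_set 2 A3"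
    and card: "card A1 = N" "card A2 = N" "card A3 = N"
  have fin: "finite A1" "finite A2" "finite A3" using conv by (auto simp: convex_set_def)
  obtain a where a: "convex2_on a N" "bij_betw a {..<N} A1"
    using convex_set_2_enumeration[OF conv(1)] card by metis
  obtain b where b: "convex2_on b N" "bij_betw b {..<N} A2"
    using convex_set_2_enumeration[OF conv(2)] card by metis
  obtain c where c: "convex2_on c N" "bij_betw c {..<N} A3"
    using convex_set_2_enumeration[OF conv(3)] card by metis
  have level: "real (card {x \<in> sumset3 A1 A2 A3. r \<le> real (rep3 A1 A2 A3 x) \<and> real (rep3 A1 A2 A3 x) < 2 * r})
      \<le> 34000 ^ 3 * real N powr (14/3) / r powr (5/2)" if "r \<ge> 1" for r
    using fin that by (intro level_set_le[OF a(1) b(1) c(1)])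
      (auto simp: sumset3_eq rep3_enumeration[OF a(2) b(2) c(2)])
  show "real (energy3 A1 A2 A3) \<le> (1 + 16 * 34000 ^ 3) * real N powr (37/9)"
    by (rule energy3_le[OF fin card _ level]) simp_all
  fix r :: real assume r: "r \<ge> 1"
  \<comment> \<open>The common constant is the one from the energy bound with
    \<open>D = 34000 ^ 3\<close>; it exceeds the level set constant.\<close>
  have "34000 ^ 3 * real N powr (14/3) / r powr (5/2) \<le> (1 + 16 * 34000 ^ 3) * real N powr (14/3) / r powr (5/2)"
    by (intro divide_right_mono mult_right_mono) auto
  then show "real (card {x \<in> sumset3 A1 A2 A3. r \<le> real (rep3 A1 A2 A3 x) \<and> real (rep3 A1 A2 A3 x) < 2 * r})
      \<le> (1 + 16 * 34000 ^ 3) * real N powr (14/3) / r powr (5/2)"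
    using level[OF r] by linarith
qed simp

end
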